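(* Let $n\ge 16$ be even and let $W_{4,n}$ be the $4$-regular Kn\"odel graph. Then $W_{4,n}$ is $\gamma$-stable if and only if (i) $n\in\{18,28\}$, or (ii) $n\equiv 0\pmod{10}$ or $n\equiv 4\pmod{10}$, or (iii) $n\ne 26$ and $n\equiv 6\pmod{10}$.
   Context: For an even integer $n\ge 2$ and $1\le\Delta\le\lfloor\log_2 n\rfloor$, the Kn\"odel graph $W_{\Delta,n}$ is the $\Delta$-regular bipartite graph on the $n$ vertices $(i,j)$, $i\in\{1,2\}$, $0\le j\le n/2-1$, in which for every $j$ the vertex $(1,j)$ is adjacent to the vertices $(2,(j+2^k-1)\bmod (n/2))$ for $k=0,1,\dots,\Delta-1$ (and there are no other edges). A set $D$ of vertices of a graph $G$ is dominating if every vertex not in $D$ is adjacent to a vertex of $D$; $\gamma(G)$ is the minimum size of a dominating set. A graph $G$ is $\gamma$-stable if $\gamma(G-u)=\gamma(G)$ for every vertex $u$ of $G$, where $G-u$ is the graph obtained by deleting $u$. *)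

theory Defs
  imports Main
begin

text \<open>Graphs are given by a finite vertex set V and a symmetric adjacency relation E;
  only edges between vertices of V are relevant.\<close>

definition dominating :: "'a set \<Rightarrow> ('a \<Rightarrow> 'a \<Rightarrow> bool) \<Rightarrow> 'a set \<Rightarrow> bool" where
  "dominating V E D \<longleftrightarrow> D \<subseteq> V \<and> (\<forall>v \<in> V - D. \<exists>d \<in> D. E v d)"

definition domination_number :: "'a set \<Rightarrow> ('a \<Rightarrow> 'a \<Rightarrow> bool) \<Rightarrow> nat" where
  "domination_number V E = Min {card D | D. dominating V E D}"

definition gamma_stable :: "'a set \<Rightarrow> ('a \<Rightarrow> 'a \<Rightarrow> bool) \<Rightarrow> bool" where
  "gamma_stable V E \<longleftrightarrow> (\<forall>u \<in> V. domination_number (V - {u}) E = domination_number V E)"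

definition knodel_V :: "nat \<Rightarrow> (nat \<times> nat) set" where
  "knodel_V n = {(i, j). i \<in> {1, 2} \<and> j < n div 2}"

definition knodel_edge :: "nat \<Rightarrow> nat \<Rightarrow> nat \<times> nat \<Rightarrow> nat \<times> nat \<Rightarrow> bool" where
  "knodel_edge \<Delta> n u v \<longleftrightarrow> fst u = 1 \<and> fst v = 2 \<and> snd u < n div 2 \<and>
     (\<exists>k < \<Delta>. snd v = (snd u + 2 ^ k - 1) mod (n div 2))"

definition knodel_adj :: "nat \<Rightarrow> nat \<Rightarrow> nat \<times> nat \<Rightarrow> nat \<times> nat \<Rightarrow> bool" where
  "knodel_adj \<Delta> n u v \<longleftrightarrow> knodel_edge \<Delta> n u v \<or> knodel_edge \<Delta> n v u"

end

theory Submission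
  imports Defs
begin

text \<open>
  Let m = n/2 = 5q + r. A vertex set D is a pair of m-periodic 0/1 sequences on the integers, where
  a x says that (1, x) is in D and b x that (2, x + 3) is in D; the excess of a vertex is the number
  of elements of D in its closed neighbourhood minus 1, and all excesses sum to 5|D| - 2m.

  On the integers, colour (1, x) by x and (2, x) by x + 1 modulo 5: then every closed neighbourhood
  contains each colour exactly once. Counting the hits of one colour class over a period of length
  5q + r telescopes and leaves only a boundary term at the seam, so |D| - 2q bounds a local quantity
  (the drift) at every position. This rules out long stretches without excess when r is 2, 3 or 4.

  Reading the sequences column by column, everything without excess is forced, and a set D that is
  too small leaves only a bounded amount of excess for a whole period. By the cycle lemma one may
  start reading where every initial segment has at most its proportional share of the excess. A
  depth-first search that respects this budget and the drift bound then dies out after a bounded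
  number of columns, which settles all large m at once; for the few remaining small m the sequences
  are also required to close up after m columns. A deleted vertex that stays undominated is put at
  the origin, where the search starts. If r = 1, the drift bound is too weak; but then some seven
  consecutive columns belong to a perfect code, and from the first later excess on, the search dies.

  Dominating sets of optimal size are a perfect code cut open at the seam, with one extra vertex if
  r is at least 3, and five sporadic sets.
\<close>

section \<open>The search\<close>

fun trues :: "bool list \<Rightarrow> nat" where
  "trues [] = 0"
| "trues (x # xs) = (if x then Suc (trues xs) else trues xs)"

text \<open>Histories list columns with the most recent first. Entry 0 of the history is the column y that
  was just read; \<open>hitsA\<close> and \<open>hitsB\<close> count the elements of D around the two vertices whose last
  neighbour lies in column y.\<close>

fun hitsA :: "bool list \<Rightarrow> bool list \<Rightarrow> nat" where
  "hitsA (a0 # a1 # a2 # a3 # a4 # as) (b0 # b1 # b2 # b3 # b4 # b5 # b6 # b7 # bs) =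
     trues [a4, b7, b6, b4, b0]"

fun hitsB :: "bool list \<Rightarrow> bool list \<Rightarrow> nat" where
  "hitsB (a0 # a1 # a2 # a3 # a4 # a5 # a6 # a7 # as) (b0 # b1 # b2 # b3 # bs) =
     trues [b3, a0, a1, a3, a7]"

type_synonym test = "bool list \<Rightarrow> bool list \<Rightarrow> bool"

text \<open>How a column is read: without bookkeeping; as the column that completes the undominated vertex;
  or at the expense of the budget, which first grows by the given amount.\<close>

datatype step = Free test | Deleted test | Paid nat test

fun charge :: "nat \<Rightarrow> nat \<Rightarrow> nat option" where
  "charge g 0 = Some g"
| "charge 0 (Suc k) = None"
| "charge (Suc g) (Suc k) = charge g k"

text \<open>The arguments \<open>k\<close> and \<open>l\<close> are the hits of the two vertices
  that a column completes: a vertex without a hit rejects the branch, and every hit after the first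
  costs one unit of budget.\<close>

fun charge2 :: "nat \<Rightarrow> nat \<Rightarrow> nat \<Rightarrow> nat option" where
  "charge2 g 0 l = None"
| "charge2 g (Suc k) 0 = None"
| "charge2 g (Suc k) (Suc l) = charge g (k + l)"

text \<open>In the \<open>Deleted\<close> case the undominated vertex is charged as if it were hit
  exactly once, so it costs nothing and does not reject the branch.\<close>

fun advance :: "step \<Rightarrow> nat \<Rightarrow> bool list \<Rightarrow> bool list \<Rightarrow> nat option" where
  "advance (Free P) g as bs = (if P as bs then Some g else None)"
| "advance (Deleted P) g as bs =
     (if hitsA as bs = 0 then if P as bs then charge2 g 1 (hitsB as bs) else None else None)"
| "advance (Paid d P) g as bs =
     (if P as bs then charge2 (g + d) (hitsA as bs) (hitsB as bs) else None)"

text \<open>Nested conditionals instead of conjunctions keep the simplifier from evaluating further branches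
  once one branch survives or a column is rejected.\<close>

fun dead :: "step list \<Rightarrow> nat \<Rightarrow> bool list \<Rightarrow> bool list \<Rightarrow> bool"
  and dead_next :: "step list \<Rightarrow> nat option \<Rightarrow> bool list \<Rightarrow> bool list \<Rightarrow> bool" where
  "dead [] g as bs = False"
| "dead (t # ts) g as bs =
     (if dead_next ts (advance t g (False # as) (False # bs)) (False # as) (False # bs) then
      if dead_next ts (advance t g (False # as) (True # bs)) (False # as) (True # bs) then
      if dead_next ts (advance t g (True # as) (False # bs)) (True # as) (False # bs) then
         dead_next ts (advance t g (True # as) (True # bs)) (True # as) (True # bs)
      else False else False else False)"
| "dead_next ts None as bs = True"
| "dead_next ts (Some g) as bs = dead ts g as bs"

text \<open>The tests \<open>window2\<close>, \<open>window3\<close> and \<open>window4\<close> say that the drift for r = 2, 3, 4 is at most s.\<close>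

fun window2 :: "nat \<Rightarrow> test" where
  "window2 s (a0 # a1 # a2 # a3 # a4 # as) (b0 # b1 # b2 # b3 # b4 # bs) =
     (trues [a0, a1, a4, b0, b3, b4] \<le> s + trues [a2, b2])"

fun window3 :: "nat \<Rightarrow> test" where
  "window3 s (a0 # a1 # a2 # a3 # a4 # a5 # as) (b0 # b1 # b2 # b3 # b4 # b5 # bs) =
     (trues [a0, a1, a5, b0, b4, b5] \<le> s)"

fun window4 :: "nat \<Rightarrow> test" where
  "window4 s (a0 # a1 # a2 # a3 # a4 # a5 # a6 # as) (b0 # b1 # b2 # b3 # b4 # b5 # b6 # bs) =
     (trues [a0, a1, a3, a6, b0, b3, b5, b6] \<le> s)"

text \<open>The five phases of the perfect code with \<open>a\<close> at a residue c and
  \<open>b\<close> at c + 1 modulo 5. Recent columns come first, so residues decrease along the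
  lists and the offset 1 shows up as 4. A vertex completed by the next column reaches back over
  seven columns.\<close>

definition perfect_states :: "(bool list \<times> bool list) list" where
  "perfect_states =
     map (\<lambda>k. (map (\<lambda>i. (i + k) mod 5 = 0) [0..<7], map (\<lambda>i. (i + k) mod 5 = 4) [0..<7])) [0..<5]"

definition imperfect :: test where
  "imperfect as bs = ((take 7 as, take 7 bs) \<notin> set perfect_states)"

fun redundant :: test where
  "redundant as bs = (2 < hitsA as bs + hitsB as bs)"

fun any :: test where "any as bs = True"

fun noB :: test where "noB as bs = (\<not> hd bs)"

fun noAB :: test where "noAB as bs = (if hd as then False else \<not> hd bs)"

text \<open>The first two paid columns always have budget 0, so the vertices that they complete cannot have
  been hit twice before; testing this early prunes the initial seven columns.\<close>

fun earlyA :: test where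
  "earlyA (a0 # as) (b0 # b1 # b2 # b3 # bs) = (trues [a0, b0, b2, b3] \<le> 1)"

fun earlyB :: "test" where
  "earlyB (a0 # a1 # a2 # a3 # a4 # a5 # a6 # as) (b0 # b1 # b2 # bs) = (trues [b2, a0, a2, a6] \<le> 1)"

fun both :: "test \<Rightarrow> test \<Rightarrow> test" where
  "both P Q as bs = (if P as bs then Q as bs else False)"

definition closes :: "nat \<Rightarrow> test" where
  "closes m as bs = (if as ! m = hd as then bs ! m = hd bs else False)"

text \<open>The \<open>earlyA\<close> tests concern the two A vertices that the first two paid
  columns complete, \<open>earlyB\<close> the B vertex that the first one completes.\<close>

definition start_steps :: "test \<Rightarrow> step list" where
  "start_steps P = map Free [any, any, any, earlyA, earlyA, any, both earlyB P]"

text \<open>After j paid columns the total budget is the floor of j R / m.\<close>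

definition prefix_steps :: "nat \<Rightarrow> nat \<Rightarrow> nat \<Rightarrow> (nat \<Rightarrow> test) \<Rightarrow> step list" where
  "prefix_steps R m N P = map (\<lambda>j. Paid (Suc j * R div m - j * R div m) (P j)) [0..<N]"

text \<open>With the undominated vertex at the origin, the drift at a seam k may exceed s by one if the colour
  class counted there contains the origin, that is, if k = r modulo 5. The columns read are
  -3, -2, and so on; the neighbours of the origin are complete with column 4.\<close>

definition limit :: "nat \<Rightarrow> nat \<Rightarrow> nat \<Rightarrow> nat" where
  "limit r s k = (if k mod 5 = r then Suc s else s)"

definition deleted_steps ::
  "nat \<Rightarrow> nat \<Rightarrow> (nat \<Rightarrow> test) \<Rightarrow> nat \<Rightarrow> nat \<Rightarrow> (nat \<Rightarrow> test) \<Rightarrow> step list" where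
  "deleted_steps r s W M N C =
     map Free [noB, noB, any, noAB, any, any, W (limit r s 4)] @ Deleted (W (limit r s 5)) #
     map (\<lambda>j. Paid 0 (W (limit r s (6 + j)))) [0..<M] @ map (\<lambda>j. Paid 0 (C j)) [0..<N]"

section \<open>Excess and the cycle lemma\<close>

primrec hist :: "(int \<Rightarrow> bool) \<Rightarrow> nat \<Rightarrow> int \<Rightarrow> bool list" where
  "hist f 0 y = []"
| "hist f (Suc n) y = f (y - 1) # hist f n (y - 1)"

lemma hist_nth: "i < n \<Longrightarrow> hist f n y ! i = f (y - 1 - int i)"
proof (induction n arbitrary: i y)
  case (Suc n)
  then show ?case by (cases i) (auto simp: algebra_simps)
qed simp

lemma hist_8:
  assumes "8 \<le> n"
  shows "\<exists>xs. hist f n (y + 1) = f y # f (y - 1) # f (y - 2) # f (y - 3) # f (y - 4) # f (y - 5) #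
    f (y - 6) # f (y - 7) # xs"
proof -
  obtain k where "n = k + 8" using assms by (metis add.commute le_Suc_ex)
  then show ?thesis by (simp add: numeral_eq_Suc)
qed

lemma hist_7:
  assumes "7 \<le> n"
  shows "\<exists>xs. hist f n y = f (y - 1) # f (y - 2) # f (y - 3) # f (y - 4) # f (y - 5) #
    f (y - 6) # f (y - 7) # xs"
proof -
  obtain k where "n = k + 7" using assms by (metis add.commute le_Suc_ex)
  then show ?thesis by (simp add: numeral_eq_Suc)
qed

text \<open>One pair of sequences traced along its own branch of the tree that \<open>dead\<close>
  explores; \<open>n\<close> columns have been read and column \<open>y\<close> is next.\<close>

fun survives :: "step list \<Rightarrow> nat \<Rightarrow> (int \<Rightarrow> bool) \<Rightarrow> (int \<Rightarrow> bool) \<Rightarrow> nat \<Rightarrow> int \<Rightarrow> bool" where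
  "survives [] g a b n y = True"
| "survives (t # ts) g a b n y =
     (case advance t g (hist a (Suc n) (y + 1)) (hist b (Suc n) (y + 1)) of
        None \<Rightarrow> False
      | Some g' \<Rightarrow> survives ts g' a b (Suc n) (y + 1))"

lemma survives_not_dead:
  "survives ts g a b n y \<Longrightarrow> \<not> dead ts g (hist a n y) (hist b n y)"
proof (induction ts arbitrary: g n y)
  case (Cons t ts)
  obtain g' where g': "advance t g (hist a (Suc n) (y + 1)) (hist b (Suc n) (y + 1)) = Some g'"
    and s: "survives ts g' a b (Suc n) (y + 1)"
    using Cons.prems by (auto split: option.splits)
  have "\<not> dead_next ts (advance t g (a y # hist a n y) (b y # hist b n y)) (a y # hist a n y) (b y # hist b n y)"
    using g' Cons.IH[OF s] by simp
  then show ?case by (cases "a y"; cases "b y") auto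
qed simp

definition excessA :: "(int \<Rightarrow> bool) \<Rightarrow> (int \<Rightarrow> bool) \<Rightarrow> int \<Rightarrow> int" where
  "excessA a b x = of_bool (a x) + of_bool (b (x - 3)) + of_bool (b (x - 2)) + of_bool (b x)
     + of_bool (b (x + 4)) - 1"

definition excessB :: "(int \<Rightarrow> bool) \<Rightarrow> (int \<Rightarrow> bool) \<Rightarrow> int \<Rightarrow> int" where
  "excessB a b x = of_bool (b x) + of_bool (a (x + 3)) + of_bool (a (x + 2)) + of_bool (a x)
     + of_bool (a (x - 4)) - 1"

definition load :: "(int \<Rightarrow> bool) \<Rightarrow> (int \<Rightarrow> bool) \<Rightarrow> int \<Rightarrow> int" where
  "load a b y = excessA a b (y - 4) + excessB a b (y - 3)"

lemma hitsA_hist: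
  assumes "8 \<le> n"
  shows "int (hitsA (hist a n (y + 1)) (hist b n (y + 1))) = excessA a b (y - 4) + 1"
proof -
  obtain as where as: "hist a n (y + 1) = a y # a (y - 1) # a (y - 2) # a (y - 3) # a (y - 4)
    # a (y - 5) # a (y - 6) # a (y - 7) # as"
    using hist_8[OF assms, of a y] by blast
  obtain bs where bs: "hist b n (y + 1) = b y # b (y - 1) # b (y - 2) # b (y - 3) # b (y - 4) # b (y - 5) # b (y - 6) # b (y - 7) # bs"
    using hist_8[OF assms, of b y] by blast
  show ?thesis by (simp add: as bs excessA_def)
qed

lemma hitsB_hist:
  assumes "8 \<le> n"
  shows "int (hitsB (hist a n (y + 1)) (hist b n (y + 1))) = excessB a b (y - 3) + 1"
proof -
  obtain as where as: "hist a n (y + 1) = a y # a (y - 1) # a (y - 2) # a (y - 3) # a (y - 4)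
    # a (y - 5) # a (y - 6) # a (y - 7) # as"
    using hist_8[OF assms, of a y] by blast
  obtain bs where bs: "hist b n (y + 1) = b y # b (y - 1) # b (y - 2) # b (y - 3) # b (y - 4) # b (y - 5) # b (y - 6) # b (y - 7) # bs"
    using hist_8[OF assms, of b y] by blast
  show ?thesis by (simp add: as bs excessB_def)
qed

lemma charge_eq: "charge g k = (if k \<le> g then Some (g - k) else None)"
  by (induction g k rule: charge.induct) auto

lemma charge2_eq:
  "charge2 g k l = (if k = 0 \<or> l = 0 \<or> g + 2 < k + l then None else Some (g + 2 - (k + l)))"
  by (cases k; cases l) (auto simp: charge_eq)

text \<open>Here \<open>G j\<close> is the budget before the j-th paid column: it grows by
  \<open>d j\<close> and pays the load of that column. The remaining steps \<open>ts\<close> allow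
  several phases to be chained.\<close>

lemma survives_Paid:
  assumes "7 \<le> n" "k \<le> N"
    and P: "\<And>j. k \<le> j \<Longrightarrow> j < N \<Longrightarrow>
      P j (hist a (Suc (n + j)) (y + int j + 1)) (hist b (Suc (n + j)) (y + int j + 1))"
    and "\<And>j. k \<le> j \<Longrightarrow> j < N \<Longrightarrow> 0 \<le> excessA a b (y + int j - 4)"
    and "\<And>j. k \<le> j \<Longrightarrow> j < N \<Longrightarrow> 0 \<le> excessB a b (y + int j - 3)"
    and "\<And>j. k \<le> j \<Longrightarrow> j < N \<Longrightarrow> G (Suc j) = G j + int (d j) - load a b (y + int j)"
    and "\<And>j. k \<le> j \<Longrightarrow> j \<le> N \<Longrightarrow> 0 \<le> G j"
    and "survives ts (nat (G N)) a b (n + N) (y + int N)"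
  shows "survives (map (\<lambda>j. Paid (d j) (P j)) [k..<N] @ ts) (nat (G k)) a b (n + k) (y + int k)"
  using assms(2-)
proof (induction k rule: inc_induct)
  case base
  then show ?case by simp
next
  case (step k)
  let ?h = "\<lambda>f. hist f (Suc (n + k)) (y + int k + 1)"
  have n: "8 \<le> Suc (n + k)" using assms(1) by simp
  have A: "int (hitsA (?h a) (?h b)) = excessA a b (y + int k - 4) + 1" by (rule hitsA_hist[OF n])
  have B: "int (hitsB (?h a) (?h b)) = excessB a b (y + int k - 3) + 1" by (rule hitsB_hist[OF n])
  have g: "0 \<le> G k" "0 \<le> G (Suc k)" "G (Suc k) = G k + int (d k) - load a b (y + int k)"
    using step.prems(4,5)[of k] step.prems(5)[of "Suc k"] step.hyps by auto
  have "advance (Paid (d k) (P k)) (nat (G k)) (?h a) (?h b) = Some (nat (G (Suc k)))"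
    using step.prems(1,2,3)[of k] step.hyps A B g
    by (auto simp: charge2_eq load_def)
  moreover have "survives (map (\<lambda>j. Paid (d j) (P j)) [Suc k..<N] @ ts) (nat (G (Suc k)))
    a b (n + Suc k) (y + int (Suc k))"
    by (rule step.IH) (use step.prems in auto)
  moreover have "y + int (Suc k) = y + int k + 1" by simp
  ultimately have "survives (Paid (d k) (P k) # map (\<lambda>j. Paid (d j) (P j)) [Suc k..<N] @ ts) (nat (G k)) a b (n + k) (y + int k)"
    by (simp only: survives.simps option.case add_Suc_right)
  then show ?case using step.hyps by (simp only: upt_conv_Cons list.map append_Cons)
qed

section \<open>Periodic sequences and their sums over a period\<close>

definition periodic :: "nat \<Rightarrow> (int \<Rightarrow> 'a) \<Rightarrow> bool" where
  "periodic m f \<longleftrightarrow> (\<forall>x. f (x + int m) = f x)"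

lemma periodic_add_mult: "periodic m f \<Longrightarrow> f (x + int m * k) = f x"
proof (induction k arbitrary: x rule: int_induct[where k = 0])
  case (step1 i)
  have "f (x + int m * (i + 1)) = f (x + int m * i + int m)" by (simp add: algebra_simps)
  also have "\<dots> = f (x + int m * i)" using step1.prems unfolding periodic_def by simp
  finally show ?case using step1 by simp
next
  case (step2 i)
  have "f (x + int m * (i - 1)) = f (x + int m * (i - 1) + int m)"
    using step2.prems unfolding periodic_def by simp
  also have "\<dots> = f (x + int m * i)" by (simp add: algebra_simps)
  finally show ?case using step2 by simp
qed simp

lemma periodic_mod: "periodic m f \<Longrightarrow> f (x mod int m) = f x"
  using periodic_add_mult[of m f "x mod int m" "x div int m"] by simp

lemma periodic_cong: "periodic m f \<Longrightarrow> x mod int m = y mod int m \<Longrightarrow> f x = f y"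
  by (metis periodic_mod)

lemma periodic_sum_shift:
  fixes f :: "int \<Rightarrow> int"
  assumes "periodic m f"
  shows "(\<Sum>i<m. f (y + int i)) = (\<Sum>i<m. f (int i))"
proof -
  have step: "(\<Sum>i<m. f (z + 1 + int i)) = (\<Sum>i<m. f (z + int i))" for z
  proof -
    have "f z + (\<Sum>i<m. f (z + int (Suc i))) = (\<Sum>i<Suc m. f (z + int i))"
      by (subst sum.lessThan_Suc_shift) simp
    also have "\<dots> = (\<Sum>i<m. f (z + int i)) + f z"
      using assms by (simp add: periodic_def)
    finally show ?thesis by (simp add: add.assoc)
  qed
  show ?thesis
  proof (induction y rule: int_induct[where k = 0])
    case (step1 i)
    then show ?case using step[of i] by simp
  next
    case (step2 i)
    then show ?case using step[of "i - 1"] by simp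
  qed simp
qed

text \<open>The cycle lemma: start at a maximum of the partial sums of c - R/m.\<close>

lemma balanced_rotation:
  fixes c :: "int \<Rightarrow> int"
  assumes per: "periodic m c" and m: "0 < m" and R: "(\<Sum>i<m. c (int i)) = R"
  obtains y where "\<And>k. int m * (\<Sum>i<k. c (y + int i)) \<le> int k * R"
proof -
  define h where "h = (\<lambda>k. int m * (\<Sum>i<k. c (int i)) - int k * R)"
  have add: "h (j + k) = h j + int m * (\<Sum>i<k. c (int j + int i)) - int k * R" for j k
    by (induction k) (auto simp: h_def algebra_simps)
  \<comment> \<open>The centred terms add up to zero over a period, so a maximum within one period
    is a global maximum.\<close>
  have h_m: "h (j + m) = h j" for j
    by (simp add: add periodic_sum_shift[OF per] R)
  have h_mod: "h (k mod m) = h k" for k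
  proof -
    have "h (k mod m + m * t) = h (k mod m)" for t
      by (induction t) (simp_all add: h_m add.assoc[symmetric] add.commute[of m])
    from this[of "k div m"] show ?thesis by simp
  qed
  have "Max (h ` {..<m}) \<in> h ` {..<m}" using m by (intro Max_in) auto
  then obtain y where "h y = Max (h ` {..<m})" by force
  then have y: "h z \<le> h y" if "z < m" for z
    using Max_ge[of "h ` {..<m}" "h z"] that by simp
  have "int m * (\<Sum>i<k. c (int y + int i)) \<le> int k * R" for k
    using y[of "(y + k) mod m"] m by (simp add: h_mod add)
  then show ?thesis by (rule that)
qed

definition weight :: "nat \<Rightarrow> (int \<Rightarrow> bool) \<Rightarrow> (int \<Rightarrow> bool) \<Rightarrow> int" where
  "weight m a b = (\<Sum>i<m. of_bool (a (int i)) + of_bool (b (int i)))"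

lemma periodic_of_bool: "periodic m a \<Longrightarrow> periodic m (\<lambda>x. of_bool (a x) :: int)"
  by (simp add: periodic_def)

lemma periodicD: "periodic m f \<Longrightarrow> f (x + int m) = f x"
  by (simp add: periodic_def)

lemma periodic_offset:
  assumes "periodic m f"
  shows "f (x + int m + k) = f (x + k)" "f (x + int m - k) = f (x - k)"
proof -
  show "f (x + int m + k) = f (x + k)" using periodicD[OF assms, of "x + k"]
    by (simp only: add.assoc add.commute[of k])
  show "f (x + int m - k) = f (x - k)" using periodicD[OF assms, of "x - k"]
    by (simp only: diff_add_eq)
qed

lemma periodic_excessA:
  assumes "periodic m a" "periodic m b"
  shows "periodic m (excessA a b)"
  unfolding periodic_def excessA_def
  by (simp add: periodicD[OF assms(1)] periodicD[OF assms(2)]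
      periodic_offset[OF assms(1)] periodic_offset[OF assms(2)])

lemma periodic_excessB:
  assumes "periodic m a" "periodic m b"
  shows "periodic m (excessB a b)"
  unfolding periodic_def excessB_def
  by (simp add: periodicD[OF assms(1)] periodicD[OF assms(2)]
      periodic_offset[OF assms(1)] periodic_offset[OF assms(2)])

lemma periodic_load:
  assumes "periodic m a" "periodic m b"
  shows "periodic m (load a b)"
  unfolding periodic_def load_def
  by (simp add: periodic_offset[OF periodic_excessA[OF assms]] periodic_offset[OF periodic_excessB[OF assms]])

text \<open>Every element of D lies in five closed neighbourhoods, and a period contains 2m
  vertices.\<close>

lemma sum_load:
  assumes a: "periodic m a" and b: "periodic m b"
  shows "(\<Sum>i<m. load a b (y + int i)) = 5 * weight m a b - 2 * int m"
proof -
  have A: "(\<Sum>i<m. of_bool (a (z + int i))) = (\<Sum>i<m. (of_bool (a (int i)) :: int))" for z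
    by (rule periodic_sum_shift[OF periodic_of_bool[OF a]])
  have B: "(\<Sum>i<m. of_bool (b (z + int i))) = (\<Sum>i<m. (of_bool (b (int i)) :: int))" for z
    by (rule periodic_sum_shift[OF periodic_of_bool[OF b]])
  have eq: "load a b (y + int i) =
      of_bool (a (y - 4 + int i)) + of_bool (b (y - 7 + int i)) + of_bool (b (y - 6 + int i))
      + of_bool (b (y - 4 + int i)) + of_bool (b (y + int i)) + of_bool (b (y - 3 + int i))
      + of_bool (a (y + int i)) + of_bool (a (y - 1 + int i)) + of_bool (a (y - 3 + int i))
      + of_bool (a (y - 7 + int i)) - 2" for i
    unfolding load_def excessA_def excessB_def by (simp add: algebra_simps)
  show ?thesis unfolding eq weight_def by (simp add: sum.distrib sum_subtractf A B)
qed

section \<open>Drift\<close>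

text \<open>The boundary term left at the seam \<open>x\<close> by the colour class that starts
  there. For r at most 4 all its terms lie in the columns x - 7 to x - 1, so seven columns of
  history determine it.\<close>

definition drift :: "nat \<Rightarrow> (int \<Rightarrow> bool) \<Rightarrow> (int \<Rightarrow> bool) \<Rightarrow> int \<Rightarrow> int" where
  "drift r a b x = (\<Sum>j<r. of_bool (a (x - int r + int j)) + of_bool (b (x - 3 - int r + int j)))
     + of_bool (a (x - int r - 3)) - of_bool (b (x - int r - 1))
       + of_bool (b (x - 1)) - of_bool (a (x - 3))"

text \<open>The vertices with excesses \<open>excessA a b (x + 5 * i)\<close> and \<open>excessB a b (x + 5 * i + 1)\<close> form
  one colour class.\<close>

lemma telescope:
  "(\<Sum>i<q. excessA a b (x + 5 * int i) + excessB a b (x + 5 * int i + 1)) + 2 * int q =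
   (\<Sum>j<5 * q. of_bool (a (x + int j)) + of_bool (b (x - 3 + int j)))
     + of_bool (b (x + 5 * int q - 1)) - of_bool (a (x + 5 * int q - 3)) - of_bool (b (x - 1))
       + of_bool (a (x - 3))"
proof (induction q)
  case (Suc q)
  define z where "z = x + 5 * int q"
  have five: "5 * Suc q = Suc (Suc (Suc (Suc (Suc (5 * q)))))" by simp
  have z: "x + int (5 * q) = z" "x + int (Suc (5 * q)) = z + 1" "x + int (Suc (Suc (5 * q))) = z + 2"
    "x + int (Suc (Suc (Suc (5 * q)))) = z + 3" "x + int (Suc (Suc (Suc (Suc (5 * q))))) = z + 4"
    "x - 3 + int (5 * q) = z - 3" "x - 3 + int (Suc (5 * q)) = z - 2"
      "x - 3 + int (Suc (Suc (5 * q))) = z - 1"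
    "x - 3 + int (Suc (Suc (Suc (5 * q)))) = z" "x - 3 + int (Suc (Suc (Suc (Suc (5 * q))))) = z + 1"
    "x + 5 * int (Suc q) - 1 = z + 4" "x + 5 * int (Suc q) - 3 = z + 2"
    by (simp_all add: z_def)
  have e: "excessA a b z + excessB a b (z + 1) + 2 =
      of_bool (a z) + of_bool (b (z - 3)) + of_bool (b (z - 2)) + of_bool (b z) + of_bool (b (z + 4))
      + of_bool (b (z + 1)) + of_bool (a (z + 4)) + of_bool (a (z + 3)) + of_bool (a (z + 1))
        + of_bool (a (z - 3))"
    by (simp add: excessA_def excessB_def add.commute)
  show ?case
    unfolding five sum.lessThan_Suc z using Suc.IH e unfolding z_def[symmetric] of_nat_Suc by algebra
qed simp

text \<open>A period splits into the 5q columns counted by \<open>telescope\<close> and r further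
  ones, which periodicity moves to the left of \<open>x\<close>. If all excesses are nonnegative,
  the drift is at most the weight minus 2q.\<close>

lemma drift_eq:
  assumes a: "periodic m a" and b: "periodic m b" and m: "m = 5 * q + r"
  shows "drift r a b x = weight m a b - 2 * int q
    - (\<Sum>i<q. excessA a b (x + 5 * int i) + excessB a b (x + 5 * int i + 1))"
proof -
  let ?S = "\<lambda>n y. \<Sum>j<n. of_bool (a (y + int j)) + (of_bool (b (y - 3 + int j)) :: int)"
  have wrap: "f (x + 5 * int q + z) = f (x - int r + z)" "f (x + 5 * int q - z) = f (x - int r - z)"
    if "periodic m f" for f :: "int \<Rightarrow> bool" and z
    using periodic_offset[OF that, of "x - int r" z] by (simp_all add: m algebra_simps)
  have "weight m a b = ?S m x"
    using periodic_sum_shift[OF periodic_of_bool[OF a], of x]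
      periodic_sum_shift[OF periodic_of_bool[OF b], of "x - 3"]
    by (simp add: weight_def sum.distrib)
  also have "\<dots> = ?S (5 * q) x + ?S r (x + 5 * int q)"
    unfolding m by (induction r) (simp_all add: algebra_simps)
  also have "?S r (x + 5 * int q) = ?S r (x - int r)"
  proof (rule sum.cong)
    fix j
    show "of_bool (a (x + 5 * int q + int j)) + (of_bool (b (x + 5 * int q - 3 + int j)) :: int) =
        of_bool (a (x - int r + int j)) + of_bool (b (x - int r - 3 + int j))"
      using wrap(1)[OF a, of "int j"] wrap(1)[OF b, of "int j - 3"] by (simp add: algebra_simps)
  qed simp
  finally show ?thesis
    using telescope[where q = q and a = a and b = b and x = x] wrap(2)[OF a, of 3] wrap(2)[OF b, of 1]
    by (simp add: drift_def algebra_simps)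
qed

definition measures_drift :: "(int \<Rightarrow> bool) \<Rightarrow> (int \<Rightarrow> bool) \<Rightarrow> nat \<Rightarrow> (nat \<Rightarrow> test) \<Rightarrow> bool" where
  "measures_drift a b r W \<longleftrightarrow>
     (\<forall>n\<ge>7. \<forall>s x. W s (hist a n x) (hist b n x) \<longleftrightarrow> drift r a b x \<le> int s)"

lemma measures_drift_window:
  "measures_drift a b 2 window2" "measures_drift a b 3 window3" "measures_drift a b 4 window4"
proof -
  have *: "window2 s (hist a n x) (hist b n x) \<longleftrightarrow> drift 2 a b x \<le> int s"
    "window3 s (hist a n x) (hist b n x) \<longleftrightarrow> drift 3 a b x \<le> int s"
    "window4 s (hist a n x) (hist b n x) \<longleftrightarrow> drift 4 a b x \<le> int s" if n: "7 \<le> n" for n s x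
  proof -
    obtain as bs where h:
      "hist a n x = a (x - 1) # a (x - 2) # a (x - 3) # a (x - 4) # a (x - 5) # a (x - 6)
        # a (x - 7) # as"
      "hist b n x = b (x - 1) # b (x - 2) # b (x - 3) # b (x - 4) # b (x - 5) # b (x - 6) # b (x - 7) # bs"
      using hist_7[OF n, of a x] hist_7[OF n, of b x] by blast
    have i: "int (trues []) = 0" "int (trues (p # ps)) = of_bool p + int (trues ps)" for p ps
      by simp_all
    have sums: "(\<Sum>j<2. f j) = f 0 + f 1" "(\<Sum>j<3. f j) = f 0 + f 1 + f 2"
      "(\<Sum>j<4. f j) = f 0 + f 1 + f 2 + f 3" for f :: "nat \<Rightarrow> int"
      by (simp_all add: eval_nat_numeral)
    \<comment> \<open>For r = 3 and r = 4 the negative terms cancel; for r = 2 two of them remain,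
      which \<open>window2\<close> has on its right-hand side.\<close>
    have d: "drift 2 a b x = of_bool (a (x - 1)) + of_bool (a (x - 2)) + of_bool (a (x - 5))
        + of_bool (b (x - 1)) + of_bool (b (x - 4))
          + of_bool (b (x - 5)) - of_bool (a (x - 3)) - of_bool (b (x - 3))"
      "drift 3 a b x = of_bool (a (x - 1)) + of_bool (a (x - 2)) + of_bool (a (x - 6))
        + of_bool (b (x - 1)) + of_bool (b (x - 5)) + of_bool (b (x - 6))"
      "drift 4 a b x = of_bool (a (x - 1)) + of_bool (a (x - 2)) + of_bool (a (x - 4))
        + of_bool (a (x - 7))
        + of_bool (b (x - 1)) + of_bool (b (x - 4)) + of_bool (b (x - 6)) + of_bool (b (x - 7))"
      by (simp_all add: drift_def sums)
    have "window2 s (hist a n x) (hist b n x)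
      \<longleftrightarrow> int (trues [a (x - 1), a (x - 2), a (x - 5), b (x - 1), b (x - 4), b (x - 5)]) \<le> int s + int (trues [a (x - 3), b (x - 3)])"
      unfolding h window2.simps by (simp only: of_nat_le_iff of_nat_add[symmetric])
    then show "window2 s (hist a n x) (hist b n x) \<longleftrightarrow> drift 2 a b x \<le> int s"
      unfolding d i by linarith
    have "window3 s (hist a n x) (hist b n x)
      \<longleftrightarrow> int (trues [a (x - 1), a (x - 2), a (x - 6), b (x - 1), b (x - 5), b (x - 6)]) \<le> int s"
      unfolding h window3.simps by (simp only: of_nat_le_iff)
    then show "window3 s (hist a n x) (hist b n x) \<longleftrightarrow> drift 3 a b x \<le> int s"
      unfolding d i by linarith
    have "window4 s (hist a n x) (hist b n x)
      \<longleftrightarrow> int (trues [a (x - 1), a (x - 2), a (x - 4), a (x - 7), b (x - 1), b (x - 4), b (x - 6), b (x - 7)]) \<le> int s"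
      unfolding h window4.simps by (simp only: of_nat_le_iff)
    then show "window4 s (hist a n x) (hist b n x) \<longleftrightarrow> drift 4 a b x \<le> int s"
      unfolding d i by linarith
  qed
  show "measures_drift a b 2 window2" "measures_drift a b 3 window3" "measures_drift a b 4 window4"
    unfolding measures_drift_def using * by blast+
qed

section \<open>Soundness of the search\<close>

text \<open>Each early test counts four of the five members of a closed neighbourhood with excess 0,
  hence at most one hit.\<close>

lemma survives_start:
  assumes A: "excessA a b (y - 4) = 0" "excessA a b (y - 3) = 0" and B: "excessB a b (y - 3) = 0"
    and P: "P (hist a 7 y) (hist b 7 y)" and ts: "survives ts g a b 7 y"
  shows "survives (start_steps P @ ts) g a b 0 (y - 7)"
proof -
  have e1: "trues [a (y - 4), b (y - 4), b (y - 6), b (y - 7)] \<le> 1"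
    using A(1) by (simp add: excessA_def of_bool_def split: if_splits)
  have e2: "trues [a (y - 3), b (y - 3), b (y - 5), b (y - 6)] \<le> 1"
    using A(2) by (simp add: excessA_def of_bool_def split: if_splits)
  have e3: "trues [b (y - 3), a (y - 1), a (y - 3), a (y - 7)] \<le> 1"
    using B by (simp add: excessB_def of_bool_def split: if_splits)
  have h: "hist f 7 y = [f (y - 1), f (y - 2), f (y - 3), f (y - 4), f (y - 5), f (y - 6), f (y - 7)]" for f
    by (simp add: numeral_eq_Suc)
  have s: "7 = Suc (Suc (Suc (Suc (Suc (Suc (Suc 0))))))" by simp
  show ?thesis
    using P ts e1 e2 e3 unfolding h unfolding s
    by (simp add: start_steps_def del: trues.simps)
qed

text \<open>After a suitable rotation the load of the first k columns is an integer of at most k R /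
  m, hence at most the floor of k R / M if M is at most m. One search with \<open>M\<close> thus
  covers all longer periods with the same total excess.\<close>

lemma not_dead_rotation:
  assumes a: "periodic m a" and b: "periodic m b" and M: "0 < M" "M \<le> m"
    and ex: "\<And>x. 0 \<le> excessA a b x" "\<And>x. 0 \<le> excessB a b x"
    and R: "5 * weight m a b - 2 * int m = int R" "2 * R < M"
    and P0: "\<And>y. P0 (hist a 7 y) (hist b 7 y)"
    and P: "\<And>j y. j < N \<Longrightarrow> P j (hist a (8 + j) y) (hist b (8 + j) y)"
  shows "\<not> dead (start_steps P0 @ prefix_steps R M N P) 0 [] []"
proof -
  have "(\<Sum>i<m. load a b (int i)) = int R" using sum_load[OF a b, of 0] R by simp
  then obtain y where y: "\<And>k. int m * (\<Sum>i<k. load a b (y + int i)) \<le> int k * int R"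
    using balanced_rotation[OF periodic_load[OF a b]] M by (metis less_le_trans)
  have load: "0 \<le> load a b x" for x using ex by (simp add: load_def)
  define S where "S = (\<lambda>k. \<Sum>i<k. load a b (y + int i))"
  have S0: "0 \<le> S k" for k unfolding S_def by (intro sum_nonneg load)
  define G where "G = (\<lambda>k. int (k * R div M) - S k)"
  have G: "0 \<le> G k" for k
  proof -
    have "int M * S k \<le> int m * S k" using M S0 by (intro mult_right_mono) auto
    also have "\<dots> \<le> int (k * R)" using y[of k] by (simp add: S_def)
    finally have "int (nat (S k) * M) \<le> int (k * R)" using S0[of k] by (simp add: mult.commute)
    then have "nat (S k) * M \<le> k * R" by (simp only: of_nat_le_iff)
    then have "nat (S k) \<le> k * R div M" using M by (simp add: less_eq_div_iff_mult_less_eq)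
    then show ?thesis using S0[of k] by (simp add: G_def)
  qed
  \<comment> \<open>Since 2R < M, the floors for k = 1 and k = 2 vanish.\<close>
  have "load a b y = 0" "load a b (y + 1) = 0"
    using G[of 1] G[of 2] R load[of y] load[of "y + 1"]
    by (simp_all add: G_def S_def numeral_2_eq_2)
  then have zero: "excessA a b (y - 4) = 0" "excessA a b (y - 3) = 0" "excessB a b (y - 3) = 0"
    using ex[of "y - 4"] ex[of "y - 3"] ex(2)[of "y - 2"] by (simp_all add: load_def)
  have "survives (map (\<lambda>j. Paid (Suc j * R div M - j * R div M) (P j))
    [0..<N] @ []) (nat (G 0)) a b (7 + 0) (y + int 0)"
  proof (rule survives_Paid)
    fix j
    assume "j < N"
    have "Suc (7 + j) = 8 + j" by simp
    then show "P j (hist a (Suc (7 + j)) (y + int j + 1)) (hist b (Suc (7 + j)) (y + int j + 1))"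
      using P[OF \<open>j < N\<close>] by metis
    have "j * R div M \<le> Suc j * R div M" by (intro div_le_mono) simp
    then show "G (Suc j) = G j + int (Suc j * R div M - j * R div M) - load a b (y + int j)"
      by (simp add: G_def S_def of_nat_diff)
  qed (use ex G in auto)
  then have "survives (prefix_steps R M N P) 0 a b 7 y"
    by (simp add: prefix_steps_def G_def S_def)
  then have "survives (start_steps P0 @ prefix_steps R M N P) 0 a b 0 (y - 7)"
    using zero P0 by (intro survives_start)
  from survives_not_dead[OF this] show ?thesis by simp
qed

text \<open>The origin contributes -1 to the total excess, so \<open>R\<close> is what all other
  vertices share. The bound \<open>M + N < m\<close> stops the reading before the copy of the origin
  at m is complete, and \<open>M + 5 \<le> m\<close> keeps every tested seam within the first
  period.\<close>

lemma not_dead_deleted: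
  assumes a: "periodic m a" and b: "periodic m b" and m: "m = 5 * q + r" "r < 5" "8 \<le> m"
    and exA: "\<And>x. \<not> int m dvd x \<Longrightarrow> 0 \<le> excessA a b x" and ex0: "excessA a b 0 = - 1"
    and exB: "\<And>x. 0 \<le> excessB a b x"
    and R: "5 * weight m a b - 2 * int m + 1 = int R"
    and s: "weight m a b = 2 * int q + int s" and W: "measures_drift a b r W" and MN: "M + N < m"
      "M + 5 \<le> m"
    and C: "\<And>j. j < N \<Longrightarrow>
      C j (hist a (9 + M + j) (6 + int (M + j))) (hist b (9 + M + j) (6 + int (M + j)))"
  shows "\<not> dead (deleted_steps r s W M N C) R [] []"
proof -
  have A0: "\<not> a 0" "\<not> b (- 3)" "\<not> b (- 2)" "\<not> b 0" "\<not> b 4"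
    using ex0 by (auto simp: excessA_def of_bool_def split: if_splits)
  have ge: "- 1 \<le> excessA a b x" for x by (simp add: excessA_def)
  have window: "W (limit r s k) (hist a n (int k))
    (hist b n (int k))" if k: "0 < k" "k \<le> m" and n: "7 \<le> n" for k n
  proof -
    let ?f = "\<lambda>i. excessA a b (int k + 5 * int i) + excessB a b (int k + 5 * int i + 1)"
    \<comment> \<open>As k is at most m and 5i is below m, the class can meet no multiple of m other
      than m itself.\<close>
    have dvd: "k + 5 * i = m" if "i < q" "int m dvd int k + 5 * int i" for i
    proof -
      have "m dvd k + 5 * i"
        using that(2) by (metis (mono_tags, lifting) int_dvd_int_iff of_nat_add of_nat_mult of_nat_numeral)
      then obtain t where t: "k + 5 * i = m * t" by (auto simp: dvd_def)
      have "k + 5 * i < m * 2" using that(1) k m by linarith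
      then have "t < 2" using t by (metis mult_less_cancel1)
      moreover have "t \<noteq> 0" using t k by (cases t) auto
      ultimately show ?thesis using t by (simp add: less_2_cases_iff)
    qed
    have "drift r a b (int k) = int s - (\<Sum>i<q. ?f i)"
      using drift_eq[OF a b m(1), of "int k"] s by simp
    moreover have "- int (limit r s k) + int s \<le> (\<Sum>i<q. ?f i)"
    proof (cases "\<exists>i<q. k + 5 * i = m")
      case False
      have "0 \<le> (\<Sum>i<q. ?f i)"
        using False dvd exA exB by (intro sum_nonneg add_nonneg_nonneg) auto
      then show ?thesis by (simp add: limit_def)
    next
      case True
      then obtain i where i: "i < q" "k + 5 * i = m" by blast
      \<comment> \<open>A class that meets the undominated vertex has k congruent to m, hence to r,
        modulo 5. This one term lowers the sum by at most 1, which \<open>limit\<close> allows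
        for.\<close>
      have "k mod 5 = (k + 5 * i) mod 5" by simp
      also have "\<dots> = r" using i(2) m by simp
      finally have lim: "limit r s k = Suc s" by (simp add: limit_def)
      have "0 \<le> (\<Sum>j\<in>{..<q} - {i}. ?f j)"
      proof (intro sum_nonneg add_nonneg_nonneg)
        fix j assume j: "j \<in> {..<q} - {i}"
        then have "\<not> int m dvd int k + 5 * int j" using dvd[of j] i by auto
        then show "0 \<le> excessA a b (int k + 5 * int j)" by (rule exA)
      qed (rule exB)
      moreover have "(\<Sum>i<q. ?f i) = ?f i + (\<Sum>j\<in>{..<q} - {i}. ?f j)"
        using i by (intro sum.remove) auto
      ultimately show ?thesis using ge[of "int k + 5 * int i"] exB[of "int k + 5 * int i + 1"] lim
        by simp
    qed
    ultimately have "drift r a b (int k) \<le> int (limit r s k)" by linarith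
    then show ?thesis using W n unfolding measures_drift_def by blast
  qed
  \<comment> \<open>The budget after column 4 and k paid columns. Column 4 also completes the B
    vertex at 1, whose excess is subtracted here; the m - 1 loads that follow use up the rest
    exactly.\<close>
  define G where "G = (\<lambda>k. int R - excessB a b 1 - (\<Sum>i<k. load a b (5 + int i)))"
  have load: "0 \<le> load a b (5 + int i)" if "Suc i < m" for i
  proof -
    have "\<not> int m dvd int (Suc i)" using that zdvd_not_zless by auto
    then show ?thesis using exA[of "int (Suc i)"] exB[of "2 + int i"] by (simp add: load_def add.commute)
  qed
  have G: "0 \<le> G k" if "k < m" for k
  proof -
    have "(\<Sum>i<k. load a b (5 + int i)) \<le> (\<Sum>i<m - 1. load a b (5 + int i))"
      using that load by (intro sum_mono2) auto
    moreover have "(\<Sum>i<m. load a b (4 + int i)) = load a b 4 + (\<Sum>i<m - 1. load a b (5 + int i))"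
    proof -
      obtain l where l: "m = Suc l" using m(3) by (cases m) simp_all
      show ?thesis unfolding l by (subst sum.lessThan_Suc_shift) (simp add: algebra_simps)
    qed
    ultimately show ?thesis using sum_load[OF a b, of 4] R ex0 by (simp add: G_def load_def)
  qed
  let ?C = "map (\<lambda>j. Paid 0 (C j)) [0..<N]"
  let ?W = "map (\<lambda>j. Paid 0 (W (limit r s (6 + j)))) [0..<M]"
  have step: "0 \<le> excessA a b (5 + int j - 4)" "0 \<le> excessB a b (5 + int j - 3)" if "Suc j < m" for j
  proof -
    have "\<not> int m dvd int (Suc j)" using that zdvd_not_zless by auto
    moreover have "5 + int j - 4 = int (Suc j)" by simp
    ultimately show "0 \<le> excessA a b (5 + int j - 4)" using exA by metis
    show "0 \<le> excessB a b (5 + int j - 3)" by (rule exB)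
  qed
  have "survives (?C @ []) (nat (G (M + 0))) a b (8 + M + 0) (5 + int M + int 0)"
  proof (rule survives_Paid[where G = "\<lambda>j. G (M + j)"])
    fix j assume "j < N"
    have e: "Suc (8 + M + j) = 9 + M + j" "5 + int M + int j + 1 = 6 + int (M + j)" by simp_all
    show "C j (hist a (Suc (8 + M + j)) (5 + int M + int j + 1))
      (hist b (Suc (8 + M + j)) (5 + int M + int j + 1))"
      unfolding e by (rule C) fact
    have j: "Suc (M + j) < m" using \<open>j < N\<close> MN by simp
    show "0 \<le> excessA a b (5 + int M + int j - 4)" "0 \<le> excessB a b (5 + int M + int j - 3)"
      using step[OF j] by (simp_all add: add.assoc)
    show "G (M + Suc j) = G (M + j) + int 0 - load a b (5 + int M + int j)"
      by (simp add: G_def add.assoc)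
  next
    fix j assume "j \<le> N"
    then show "0 \<le> G (M + j)" using MN by (intro G) simp
  qed auto
  then have "survives ?C (nat (G M)) a b (8 + M) (5 + int M)" by simp
  then have "survives (?W @ ?C) (nat (G 0)) a b (8 + 0) (5 + int 0)"
  proof (intro survives_Paid)
    fix j assume "j < M"
    then have j: "Suc j < m" "6 + j \<le> m + 4" using MN by auto
    show "0 \<le> excessA a b (5 + int j - 4)" "0 \<le> excessB a b (5 + int j - 3)"
      using step[OF j(1)] by simp_all
    show "G (Suc j) = G j + int 0 - load a b (5 + int j)" by (simp add: G_def)
  next
    fix j assume "j \<le> M"
    then show "0 \<le> G j" using MN by (intro G) simp
  next
    fix j assume "j < M"
    then have "W (limit r s (6 + j)) (hist a (9 + j) (int (6 + j))) (hist b (9 + j) (int (6 + j)))"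
      using MN(2) by (intro window) auto
    moreover have "Suc (8 + j) = 9 + j" "5 + int j + 1 = int (6 + j)" by simp_all
    ultimately show "W (limit r s (6 + j)) (hist a (Suc (8 + j)) (5 + int j + 1))
      (hist b (Suc (8 + j)) (5 + int j + 1))"
      by metis
  qed auto
  then have paid: "survives (?W @ ?C) (nat (G 0)) a b 8 5" by simp
  have "int (hitsA (hist a 8 5) (hist b 8 5)) = 0"
    "int (hitsB (hist a 8 5) (hist b 8 5)) = excessB a b 1 + 1"
    using hitsA_hist[of 8 a 4 b] hitsB_hist[of 8 a 4 b] ex0 by simp_all
  moreover have "W (limit r s 5) (hist a 8 5) (hist b 8 5)"
    using window[of 5 8] m(3) by simp
  moreover have "0 \<le> G 0" using m(3) by (intro G) simp
  ultimately have "advance (Deleted (W (limit r s 5))) R (hist a 8 5) (hist b 8 5) = Some (nat (G 0))"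
    using exB[of 1] by (auto simp: charge2_eq G_def)
  moreover have "Suc 7 = 8" "4 + 1 = (5 :: int)" by simp_all
  ultimately have "survives (Deleted (W (limit r s 5)) # ?W @ ?C) R a b 7 4"
    using paid by (simp only: survives.simps option.case)
  moreover have "W (limit r s 4) (hist a 7 4) (hist b 7 4)"
    using window[of 4 7] m(3) by simp
  moreover have h: "hist f 7 4 = [f 3, f 2, f 1, f 0, f (- 1), f (- 2), f (- 3)]" for f
    by (simp add: numeral_eq_Suc)
  moreover have "7 = Suc (Suc (Suc (Suc (Suc (Suc (Suc 0))))))" by simp
  ultimately have "survives (deleted_steps r s W M N C) R a b 0 (- 3)"
    using A0 unfolding deleted_steps_def by simp
  from survives_not_dead[OF this] show ?thesis by simp
qed

section \<open>Search results\<close>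

text \<open>For weight 2q + s the total excess is R = 5s - 2r, here 7 with r = 4 and s = 3. Seven
  initial and twelve paid columns fill the period 19; the last seven must repeat the first
  seven.\<close>

lemma search4_19:
  "dead (start_steps (window4 3) @
     prefix_steps 7 19 19 (\<lambda>j. if j < 12 then window4 3 else closes 19)) 0 [] []"
  by code_simp

lemma search4_24:
  "dead (start_steps (window4 3) @
     prefix_steps 7 24 24 (\<lambda>j. if j < 17 then window4 3 else closes 24)) 0 [] []"
  by code_simp

lemma search4_29:
  "dead (start_steps (window4 3) @
     prefix_steps 7 29 29 (\<lambda>j. if j < 22 then window4 3 else closes 29)) 0 [] []"
  by code_simp

text \<open>Twenty columns exhaust every branch although the budget grows at the rate 7/34; longer
  periods only make it grow more slowly.\<close>

lemma search4_large:
  "dead (start_steps (window4 3) @ prefix_steps 7 34 20 (\<lambda>j. window4 3)) 0 [] []"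
  by code_simp

lemma search4_14:
  "dead (start_steps (window4 2) @ prefix_steps 2 14 14 (\<lambda>j. window4 2)) 0 [] []"
  by code_simp

lemma search3_13:
  "dead (start_steps (window3 2) @
     prefix_steps 4 13 13 (\<lambda>j. if j < 6 then window3 2 else closes 13)) 0 [] []"
  by code_simp

lemma search3_large:
  "dead (start_steps (window3 2) @ prefix_steps 4 23 14 (\<lambda>j. window3 2)) 0 [] []"
  by code_simp

lemma search2:
  "dead (start_steps (window2 1) @ prefix_steps 1 12 12 (\<lambda>j. window2 1)) 0 [] []"
  by code_simp

lemma search1_11:
  "dead (start_steps any @
     prefix_steps 3 11 11 (\<lambda>j. if j < 4 then any else closes 11)) 0 [] []"
  by code_simp

text \<open>For r = 1 this forces some window of seven columns to agree with the perfect
  code.\<close>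

lemma search1_large:
  "dead (start_steps imperfect @ prefix_steps 3 16 16 (\<lambda>j. imperfect)) 0 [] []"
  by code_simp

text \<open>From a perfect window followed by a column with positive load, even the whole excess 3,
  available at once, does not last for sixteen columns.\<close>

lemma search1_perfect:
  "list_all (\<lambda>(as, bs).
     dead (map (\<lambda>j. Paid 0 (if j = 0 then redundant else any)) [0..<16]) 3 as bs) perfect_states"
  by code_simp

lemma search1_stay:
  "list_all (\<lambda>(as, bs). dead [Paid 0 imperfect] 0 as bs) perfect_states"
  by code_simp

text \<open>Now R = 5s - 2r + 1. The eight columns -3 to 4 and 15 paid ones fill the period; the
  seven closing columns must repeat the columns -3 to 3.\<close>

lemma deleted_search3_23:
  "dead (deleted_steps 3 2 window3 15 7 (\<lambda>j. closes 23)) 5 [] []"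
  by code_simp

lemma deleted_search3_28:
  "dead (deleted_steps 3 2 window3 20 7 (\<lambda>j. closes 28)) 5 [] []"
  by code_simp

lemma deleted_search3_large:
  "dead (deleted_steps 3 2 window3 28 0 (\<lambda>j. any)) 5 [] []"
  by code_simp

lemma deleted_search2_12:
  "dead (deleted_steps 2 1 window2 4 7 (\<lambda>j. closes 12)) 2 [] []"
  by code_simp

lemma deleted_search2_17:
  "dead (deleted_steps 2 1 window2 9 7 (\<lambda>j. closes 17)) 2 [] []"
  by code_simp

lemma deleted_search2_large:
  "dead (deleted_steps 2 1 window2 13 0 (\<lambda>j. any)) 2 [] []"
  by code_simp

text \<open>With weight 2q + 1 the budget is 0: every vertex except the origin would have to be hit
  exactly once.\<close>

lemma deleted_search3_8:
  "dead (deleted_steps 3 1 window3 0 7 (\<lambda>j. closes 8)) 0 [] []"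
  by code_simp

lemma deleted_search3_18:
  "dead (deleted_steps 3 1 window3 9 0 (\<lambda>j. any)) 0 [] []"
  by code_simp

lemma deleted_search4_14:
  "dead (deleted_steps 4 2 window4 6 7 (\<lambda>j. closes 14)) 3 [] []"
  by code_simp

section \<open>Sequences that are too light\<close>

definition covering :: "nat \<Rightarrow> (int \<Rightarrow> bool) \<Rightarrow> (int \<Rightarrow> bool) \<Rightarrow> bool" where
  "covering m a b \<longleftrightarrow> periodic m a \<and> periodic m b \<and>
     (\<forall>x. 0 \<le> excessA a b x) \<and> (\<forall>x. 0 \<le> excessB a b x)"

definition covering_but_0 :: "nat \<Rightarrow> (int \<Rightarrow> bool) \<Rightarrow> (int \<Rightarrow> bool) \<Rightarrow> bool" where
  "covering_but_0 m a b \<longleftrightarrow> periodic m a \<and> periodic m b \<and>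
     (\<forall>x. \<not> int m dvd x \<longrightarrow> 0 \<le> excessA a b x) \<and> (\<forall>x. 0 \<le> excessB a b x)"

text \<open>Either D dominates the deleted vertex as well, and hence the whole graph, or the closed
  neighbourhood of that vertex misses D. The two cases need different searches.\<close>

lemma covering_but_0_cases:
  assumes "covering_but_0 m a b"
  obtains "covering m a b" | "excessA a b 0 = - 1"
proof (cases "0 \<le> excessA a b 0")
  case True
  have "0 \<le> excessA a b x" for x
  proof (cases "int m dvd x")
    case True
    then obtain k where "x = 0 + int m * k" by auto
    then have "excessA a b x = excessA a b 0"
      using assms periodic_add_mult[OF periodic_excessA] unfolding covering_but_0_def by metis
    then show ?thesis using \<open>0 \<le> excessA a b 0\<close> by simp
  qed (use assms in \<open>simp add: covering_but_0_def\<close>)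
  then show ?thesis using assms by (intro that(1)) (simp add: covering_def covering_but_0_def)
next
  case False
  then show ?thesis by (intro that(2)) (simp add: excessA_def of_bool_def split: if_splits)
qed

lemma closes_hist:
  assumes "periodic m a" "periodic m b" "m < n"
  shows "closes m (hist a n y) (hist b n y)"
proof -
  have "hd (hist f n y) = f (y - 1)" for f using assms(3) by (cases n) simp_all
  moreover have "f (y - 1 - int m) = f (y - 1)" if "periodic m f" for f :: "int \<Rightarrow> bool"
    using periodicD[OF that, of "y - 1 - int m"] by simp
  ultimately show ?thesis using assms by (simp add: closes_def hist_nth)
qed

lemma covering_window:
  assumes "covering m a b" "m = 5 * q + r" "weight m a b = 2 * int q + int s"
    "measures_drift a b r W" "7 \<le> n"
  shows "W s (hist a n y) (hist b n y)"
proof -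
  have "0 \<le> (\<Sum>i<q. excessA a b (y + 5 * int i) + excessB a b (y + 5 * int i + 1))"
    using assms(1) by (intro sum_nonneg add_nonneg_nonneg) (auto simp: covering_def)
  then have "drift r a b y \<le> int s"
    using drift_eq[of m a b q r y] assms by (simp add: covering_def)
  then show ?thesis using assms unfolding measures_drift_def by blast
qed

lemma covering_not_dead:
  assumes "covering m a b" "0 < M" "M \<le> m" "5 * weight m a b - 2 * int m = int R" "2 * R < M"
    and "\<And>y. P0 (hist a 7 y) (hist b 7 y)"
    and "\<And>j y. j < N \<Longrightarrow> P j (hist a (8 + j) y) (hist b (8 + j) y)"
  shows "\<not> dead (start_steps P0 @ prefix_steps R M N P) 0 [] []"
  using assms unfolding covering_def by (intro not_dead_rotation) auto

lemma covering_closed_not_dead: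
  assumes c: "covering m a b" and m: "8 \<le> m" and R: "5 * weight m a b - 2 * int m = int R" "2 * R < m"
    and P: "\<And>n y. 7 \<le> n \<Longrightarrow> P (hist a n y) (hist b n y)"
  shows "\<not> dead (start_steps P @ prefix_steps R m m (\<lambda>j. if j < m - 7 then P else closes m)) 0 [] []"
proof (rule covering_not_dead[OF c _ _ R])
  fix j y
  show "(if j < m - 7 then P else closes m) (hist a (8 + j) y) (hist b (8 + j) y)"
    using P[of "8 + j"] closes_hist[of m a b "8 + j"] c by (auto simp: covering_def)
qed (use m P in auto)

lemma deleted_closed_not_dead:
  assumes c: "covering_but_0 m a b" and ex0: "excessA a b 0 = - 1"
    and m: "m = 5 * q + r" "r < 5" "8 \<le> m"
    and R: "5 * weight m a b - 2 * int m + 1 = int R" and s: "weight m a b = 2 * int q + int s"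
    and W: "measures_drift a b r W"
  shows "\<not> dead (deleted_steps r s W (m - 8) 7 (\<lambda>j. closes m)) R [] []"
proof (rule not_dead_deleted[OF _ _ m _ ex0 _ R s W])
  fix j :: nat
  show "closes m (hist a (9 + (m - 8) + j) (6 + int (m - 8 + j)))
    (hist b (9 + (m - 8) + j) (6 + int (m - 8 + j)))"
    using c m(3) by (intro closes_hist) (auto simp: covering_but_0_def)
qed (use c m(3) in \<open>auto simp: covering_but_0_def\<close>)

lemma deleted_open_not_dead:
  assumes c: "covering_but_0 m a b" and ex0: "excessA a b 0 = - 1"
    and m: "m = 5 * q + r" "r < 5" "8 \<le> m"
    and R: "5 * weight m a b - 2 * int m + 1 = int R" and s: "weight m a b = 2 * int q + int s"
    and W: "measures_drift a b r W" and M: "M + 5 \<le> m"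
  shows "\<not> dead (deleted_steps r s W M 0 (\<lambda>j. any)) R [] []"
  by (rule not_dead_deleted[OF _ _ m _ ex0 _ R s W]) (use c M in \<open>auto simp: covering_but_0_def\<close>)

lemma take_hist: "take k (hist f n y) = hist f (min k n) y"
proof (induction k arbitrary: n y)
  case (Suc k)
  then show ?case by (cases n) auto
qed simp

lemma imperfect_hist:
  "7 \<le> n \<Longrightarrow> imperfect (hist a n y) (hist b n y) \<longleftrightarrow> imperfect (hist a 7 y) (hist b 7 y)"
  by (simp add: imperfect_def take_hist)

lemma perfect_iff: "\<not> imperfect (hist a 7 y) (hist b 7 y)
  \<longleftrightarrow> (hist a 7 y, hist b 7 y) \<in> set perfect_states"
  by (simp add: imperfect_def take_hist)

lemma no_covering_1:
  assumes c: "covering m a b" and m: "m = 5 * q + 1" "11 \<le> m"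
  shows "weight m a b \<noteq> 2 * int q + 1"
proof
  assume w: "weight m a b = 2 * int q + 1"
  have R: "5 * weight m a b - 2 * int m = int 3" using w m by simp
  have ex: "0 \<le> excessA a b x" "0 \<le> excessB a b x" for x using c by (simp_all add: covering_def)
  have load: "0 \<le> load a b x" for x using ex by (simp add: load_def)
  have total: "(\<Sum>i<m. load a b (z + int i)) = 3" for z
    using sum_load[of m a b z] c R by (simp add: covering_def)
  show False
  proof (cases "m = 11")
    case True
    show ?thesis using covering_closed_not_dead[OF c _ R, of any] search1_11 unfolding True by simp
  next
    case False
    then have m16: "16 \<le> m" using m by presburger
    have "\<exists>y. \<not> imperfect (hist a 7 y) (hist b 7 y)"
    proof (rule ccontr)
      assume "\<not> ?thesis"
      then have "imperfect (hist a n y) (hist b n y)" if "7 \<le> n" for n y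
        using imperfect_hist[OF that] by blast
      then show False using covering_not_dead[OF c _ m16 R, of imperfect 16 "\<lambda>j. imperfect"] search1_large by simp
    qed
    then obtain y where y: "(hist a 7 y, hist b 7 y) \<in> set perfect_states" using perfect_iff by blast
    have "\<exists>i. 0 < load a b (y + int i)"
    proof (rule ccontr)
      assume "\<not> ?thesis"
      then have "load a b (y + int i) = 0" for i
        using load[of "y + int i"] by (meson not_less order_antisym)
      then show False using total[of y] by simp
    qed
    define k where "k = (LEAST i. 0 < load a b (y + int i))"
    have k: "0 < load a b (y + int k)"
      unfolding k_def by (rule LeastI_ex) fact
    have before: "load a b (y + int i) = 0" if "i < k" for i
      using not_less_Least[of i "\<lambda>i. 0 < load a b (y + int i)"] that load[of "y + int i"]
      unfolding k_def by (meson not_less order_antisym)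
    \<comment> \<open>By \<open>search1_stay\<close> a column without load can only continue the
      perfect code.\<close>
    have perfect: "(hist a 7 (y + int i), hist b 7 (y + int i)) \<in> set perfect_states" if "i \<le> k" for i
      using that
    proof (induction i)
      case 0
      then show ?case using y by simp
    next
      case (Suc i)
      let ?y = "y + int i"
      have "\<not> survives (map (\<lambda>j. Paid 0 imperfect) [0..<1] @ []) (nat 0) a b (7 + 0) (?y + int 0)"
        using survives_not_dead[of "[Paid 0 imperfect]" 0 a b 7 ?y] search1_stay Suc
          by (auto simp: list_all_iff)
      moreover have "survives (map (\<lambda>j. Paid 0 imperfect) [0..<1] @ []) (nat 0) a b (7 + 0) (?y + int 0)"
        if "imperfect (hist a 8 (?y + 1)) (hist b 8 (?y + 1))"
        using that before[of i] Suc.prems ex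
        by (intro survives_Paid[where G = "\<lambda>_. 0" and P = "\<lambda>_. imperfect" and d = "\<lambda>_. 0"]) auto
      ultimately have "\<not> imperfect (hist a 7 (?y + 1)) (hist b 7 (?y + 1))"
        using imperfect_hist[of 8 a "?y + 1" b] by auto
      then show ?case using perfect_iff[of a "?y + 1" b] by (simp add: algebra_simps)
    qed
    let ?z = "y + int k"
    let ?P = "\<lambda>j :: nat. if j = 0 then redundant else any"
    \<comment> \<open>Sixteen columns are at most one period, so their loads add up to at most
      3.\<close>
    define G where "G = (\<lambda>j. 3 - (\<Sum>i<j. load a b (?z + int i)))"
    have "survives (map (\<lambda>j. Paid 0 (?P j)) [0..<16] @ []) (nat (G 0)) a b (7 + 0) (?z + int 0)"
    proof (rule survives_Paid)
      fix j :: nat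
      assume "j \<le> 16"
      then have "(\<Sum>i<j. load a b (?z + int i)) \<le> (\<Sum>i<m. load a b (?z + int i))"
        using m16 load by (intro sum_mono2) auto
      then show "0 \<le> G j" using total[of ?z] by (simp add: G_def)
    next
      fix j :: nat
      have "redundant (hist a 8 (?z + 1)) (hist b 8 (?z + 1))"
        using hitsA_hist[of 8 a ?z b] hitsB_hist[of 8 a ?z b] k by (simp add: load_def)
      then show "?P j (hist a (Suc (7 + j)) (?z + int j + 1)) (hist b (Suc (7 + j)) (?z + int j + 1))"
        by (cases j) (auto simp del: redundant.simps hist.simps)
    qed (auto simp: G_def ex)
    then have "survives (map (\<lambda>j. Paid 0 (?P j)) [0..<16]) 3 a b 7 ?z"
      unfolding G_def by simp
    from survives_not_dead[OF this] show False
      using search1_perfect perfect[of k] by (auto simp: list_all_iff)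
  qed
qed

lemma no_covering_4:
  assumes c: "covering m a b" and m: "m = 5 * q + 4" "19 \<le> m"
  shows "weight m a b \<noteq> 2 * int q + 3"
proof
  assume w: "weight m a b = 2 * int q + 3"
  have R: "5 * weight m a b - 2 * int m = int 7" using w m by simp
  have W: "window4 3 (hist a n y) (hist b n y)" if "7 \<le> n" for n y
    using covering_window[OF c m(1) _ measures_drift_window(3) that] w by simp
  \<comment> \<open>The search with M = 34 requires m to be at least 34; the three smaller periods
    are closed up instead.\<close>
  have "m = 19 \<or> m = 24 \<or> m = 29 \<or> 34 \<le> m" using m by presburger
  then consider "m = 19" | "m = 24" | "m = 29" | "34 \<le> m" by blast
  then show False
  proof cases
    case 1
    show ?thesis using covering_closed_not_dead[OF c _ R, of "window4 3"] W search4_19 unfolding 1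
      by simp
  next
    case 2
    show ?thesis using covering_closed_not_dead[OF c _ R, of "window4 3"] W search4_24 unfolding 2
      by simp
  next
    case 3
    show ?thesis using covering_closed_not_dead[OF c _ R, of "window4 3"] W search4_29 unfolding 3
      by simp
  next
    case 4
    show ?thesis using covering_not_dead[OF c _ 4 R, of "window4 3" 20 "\<lambda>j. window4 3"] W search4_large by simp
  qed
qed

lemma no_covering_13:
  assumes c: "covering 13 a b"
  shows "weight 13 a b \<noteq> 6"
proof
  assume w: "weight 13 a b = 6"
  have R: "5 * weight 13 a b - 2 * int 13 = int 4" using w by simp
  have W: "window3 2 (hist a n y) (hist b n y)" if "7 \<le> n" for n y
    using covering_window[OF c, of 2 3 2 window3, OF _ _ measures_drift_window(2) that] w by simp
  show False using covering_closed_not_dead[OF c _ R, of "window3 2"] W search3_13 by simp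
qed

section \<open>Lower bounds after the deletion of a vertex\<close>

lemma covering_but_0_weight:
  assumes "covering_but_0 m a b"
  shows "2 * int m \<le> 5 * weight m a b + 1"
proof -
  have per: "periodic m a" "periodic m b" using assms by (simp_all add: covering_but_0_def)
  show ?thesis
  proof (cases m)
    case (Suc l)
    \<comment> \<open>Starting the period at column 4 puts the exempt vertex into the first load;
      all other loads are nonnegative.\<close>
    have "- 1 \<le> load a b (4 + int 0)" using assms by (simp add: load_def covering_but_0_def excessA_def)
    moreover have "0 \<le> (\<Sum>i<l. load a b (4 + int (Suc i)))"
    proof (rule sum_nonneg)
      fix i assume "i \<in> {..<l}"
      then have "\<not> int m dvd int (Suc i)" using Suc zdvd_not_zless by auto
      then have "0 \<le> excessA a b (int (Suc i))" using assms unfolding covering_but_0_def by blast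
      then show "0 \<le> load a b (4 + int (Suc i))"
        using assms by (simp add: load_def covering_but_0_def)
    qed
    ultimately show ?thesis
      using sum_load[OF per, of 4] unfolding Suc by (simp add: sum.lessThan_Suc_shift del: sum.lessThan_Suc)
  qed (simp add: weight_def)
qed

lemma no_deletion_2:
  assumes c: "covering_but_0 m a b" and m: "m = 5 * q + 2" "12 \<le> m"
  shows "weight m a b \<noteq> 2 * int q + 1"
proof
  assume w: "weight m a b = 2 * int q + 1"
  from c show False
  proof (cases rule: covering_but_0_cases)
    case 1
    have W: "window2 1 (hist a n y) (hist b n y)" if "7 \<le> n" for n y
      using covering_window[OF 1 m(1) _ measures_drift_window(1) that] w by simp
    show ?thesis
      using covering_not_dead[OF 1 _ m(2), of 1 "window2 1" 12 "\<lambda>j. window2 1"] W search2 w m by simp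
  next
    case 2
    have R: "5 * weight m a b - 2 * int m + 1 = int 2" using w m by simp
    note closed = deleted_closed_not_dead[OF c 2 m(1) _ _ R _ measures_drift_window(1), of 1]
    \<comment> \<open>The open search has 13 paid columns and thus requires m to be at least
      18.\<close>
    have "m = 12 \<or> m = 17 \<or> 22 \<le> m" using m by presburger
    then consider "m = 12" | "m = 17" | "22 \<le> m" by blast
    then show ?thesis
    proof cases
      assume "m = 12"
      then show ?thesis using closed w deleted_search2_12 by simp
    next
      assume "m = 17"
      then show ?thesis using closed w deleted_search2_17 by simp
    next
      assume "22 \<le> m"
      then show ?thesis
        using deleted_open_not_dead[OF c 2 m(1) _ _ R _ measures_drift_window(1), of 1 13] w deleted_search2_large by simp
    qed
  qed
qed

lemma no_deletion_3:
  assumes c: "covering_but_0 m a b" and m: "m = 5 * q + 3" "23 \<le> m"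
  shows "weight m a b \<noteq> 2 * int q + 2"
proof
  assume w: "weight m a b = 2 * int q + 2"
  from c show False
  proof (cases rule: covering_but_0_cases)
    case 1
    have W: "window3 2 (hist a n y) (hist b n y)" if "7 \<le> n" for n y
      using covering_window[OF 1 m(1) _ measures_drift_window(2) that] w by simp
    show ?thesis
      using covering_not_dead[OF 1 _ m(2), of 4 "window3 2" 14 "\<lambda>j. window3 2"] W search3_large w m
        by simp
  next
    case 2
    have R: "5 * weight m a b - 2 * int m + 1 = int 5" using w m by simp
    note closed = deleted_closed_not_dead[OF c 2 m(1) _ _ R _ measures_drift_window(2), of 2]
    have "m = 23 \<or> m = 28 \<or> 33 \<le> m" using m by presburger
    then consider "m = 23" | "m = 28" | "33 \<le> m" by blast
    then show ?thesis
    proof cases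
      assume "m = 23"
      then show ?thesis using closed w deleted_search3_23 by simp
    next
      assume "m = 28"
      then show ?thesis using closed w deleted_search3_28 by simp
    next
      assume "33 \<le> m"
      then show ?thesis
        using deleted_open_not_dead[OF c 2 m(1) _ _ R _ measures_drift_window(2), of 2 28] w deleted_search3_large by simp
    qed
  qed
qed

lemma no_deletion_8:
  assumes c: "covering_but_0 8 a b"
  shows "weight 8 a b \<noteq> 3"
proof
  assume w: "weight 8 a b = 3"
  from c show False
  proof (cases rule: covering_but_0_cases)
    case 1
    \<comment> \<open>The total excess would be 15 - 16 = -1.\<close>
    then have "0 \<le> (\<Sum>i<8. load a b (0 + int i))"
      by (intro sum_nonneg) (simp add: load_def covering_def)
    then show ?thesis using sum_load[of 8 a b 0] w c by (simp add: covering_but_0_def)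
  next
    case 2
    show ?thesis
      using deleted_closed_not_dead[OF c 2, of 1 3 0 1, OF _ _ _ _ _ measures_drift_window(2)] w deleted_search3_8 by simp
  qed
qed

lemma no_deletion_18:
  assumes c: "covering_but_0 18 a b"
  shows "weight 18 a b \<noteq> 7"
proof
  assume w: "weight 18 a b = 7"
  from c show False
  proof (cases rule: covering_but_0_cases)
    case 1
    then have "0 \<le> (\<Sum>i<18. load a b (0 + int i))"
      by (intro sum_nonneg) (simp add: load_def covering_def)
    then show ?thesis using sum_load[of 18 a b 0] w c by (simp add: covering_but_0_def)
  next
    case 2
    show ?thesis
      using deleted_open_not_dead[OF c 2, of 3 3 0 1 _ 9, OF _ _ _ _ _ measures_drift_window(2)] w deleted_search3_18 by simp
  qed
qed

lemma no_deletion_14: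
  assumes c: "covering_but_0 14 a b"
  shows "weight 14 a b \<noteq> 6"
proof
  assume w: "weight 14 a b = 6"
  from c show False
  proof (cases rule: covering_but_0_cases)
    case 1
    have W: "window4 2 (hist a n y) (hist b n y)" if "7 \<le> n" for n y
      using covering_window[OF 1, of 2 4 2 window4, OF _ _ measures_drift_window(3) that] w by simp
    show ?thesis
      using covering_not_dead[OF 1, of 14 2 "window4 2" 14 "\<lambda>j. window4 2"] W search4_14 w by simp
  next
    case 2
    show ?thesis
      using deleted_closed_not_dead[OF c 2, of 2 4 3 2, OF _ _ _ _ _ measures_drift_window(3)] w deleted_search4_14 by simp
  qed
qed

section \<open>Back to the graph\<close>

text \<open>A frame is an identification of the graph with the standard coordinates; translations and the
  reflection that swaps the sides show that any vertex can be put at any position \<open>vA x0\<close>.\<close>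

definition frame :: "nat \<Rightarrow> (int \<Rightarrow> nat \<times> nat) \<Rightarrow> (int \<Rightarrow> nat \<times> nat) \<Rightarrow> bool" where
  "frame n vA vB \<longleftrightarrow>
     (\<forall>x y. vA x = vA y \<longleftrightarrow> x mod int (n div 2) = y mod int (n div 2)) \<and>
     (\<forall>x y. vB x = vB y \<longleftrightarrow> x mod int (n div 2) = y mod int (n div 2)) \<and>
     (\<forall>x y. vA x \<noteq> vB y) \<and> knodel_V n = range vA \<union> range vB \<and>
     (\<forall>x w. knodel_adj 4 n (vA x) w \<longleftrightarrow> w \<in> {vB (x - 3), vB (x - 2), vB x, vB (x + 4)}) \<and>
     (\<forall>x w. knodel_adj 4 n (vB x) w \<longleftrightarrow> w \<in> {vA (x + 3), vA (x + 2), vA x, vA (x - 4)})"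

lemma frameD:
  assumes "frame n vA vB"
  shows "vA x = vA y \<longleftrightarrow> x mod int (n div 2) = y mod int (n div 2)"
    and "vB x = vB y \<longleftrightarrow> x mod int (n div 2) = y mod int (n div 2)"
    and "vA x \<noteq> vB y" and "knodel_V n = range vA \<union> range vB"
    and "knodel_adj 4 n (vA x) w \<longleftrightarrow> w \<in> {vB (x - 3), vB (x - 2), vB x, vB (x + 4)}"
    and "knodel_adj 4 n (vB x) w \<longleftrightarrow> w \<in> {vA (x + 3), vA (x + 2), vA x, vA (x - 4)}"
  using assms unfolding frame_def by - (elim conjE, iprover)+

lemma mod_add_cancel_int: "((x :: int) + k) mod m = (y + k) mod m \<longleftrightarrow> x mod m = y mod m"
  by (simp add: mod_eq_dvd_iff)

lemma mod_minus_cancel_int: "((k :: int) - x) mod m = (k - y) mod m \<longleftrightarrow> x mod m = y mod m"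
proof -
  have "k - x - (k - y) = y - x" by simp
  then show ?thesis unfolding mod_eq_dvd_iff by (simp only: dvd_diff_commute[of m y x])
qed

lemma knodel_edge_4:
  "knodel_edge 4 n u v \<longleftrightarrow> fst u = 1 \<and> fst v = 2 \<and> snd u < n div 2 \<and>
     (\<exists>d\<in>{0, 1, 3, 7}. snd v = (snd u + d) mod (n div 2))"
proof -
  have "(\<exists>k<4. P (2 ^ k)) \<longleftrightarrow> P 1 \<or> P 2 \<or> P 4 \<or> P (8 :: nat)" for P
  proof -
    have "(\<exists>k<4. Q k) \<longleftrightarrow> Q 0 \<or> Q 1 \<or> Q 2 \<or> Q (3 :: nat)" for Q
    proof -
      have "{..<4} = {0, 1, 2, 3 :: nat}" by auto
      then show ?thesis by (metis insert_iff lessThan_iff singletonD)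
    qed
    from this[of "\<lambda>k. P (2 ^ k)"] show ?thesis by simp
  qed
  note this[of "\<lambda>t. snd v = (snd u + t - 1) mod (n div 2)"] 
  moreover have "snd u + 1 - 1 = snd u + 0" "snd u + 2 - 1 = snd u + 1" "snd u + 4 - 1 = snd u + 3"
    "snd u + 8 - 1 = snd u + 7" by simp_all
  ultimately show ?thesis
    unfolding knodel_edge_def by (simp only: bex_simps simp_thms)
qed
text \<open>The shift by 3 on side 2 turns the offsets 0, 1, 3, 7 into -3, -2, 0, 4, so that a
  closed neighbourhood reaches about equally far in both directions.\<close>

lemma frame_standard:
  assumes m: "0 < n div 2"
  shows "frame n (\<lambda>x. (1, nat (x mod int (n div 2)))) (\<lambda>x. (2, nat ((x + 3) mod int (n div 2))))"
proof -
  define m where "m = n div 2"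
  have m0: "0 < m" using m by (simp add: m_def)
  have nat_eq: "nat (x mod int m) = nat (y mod int m) \<longleftrightarrow> x mod int m = y mod int m" for x y
    using m0 by (simp add: eq_nat_nat_iff)
  have less: "nat (x mod int m) < m" for x
    using m0 by (simp add: nat_less_iff)
  have shift: "(nat (x mod int m) + d) mod m = nat ((x + int d) mod int m)" for x d
  proof -
    have "int ((nat (x mod int m) + d) mod m) = (x + int d) mod int m"
      using m0 by (simp add: of_nat_mod mod_simps)
    then show ?thesis by (metis nat_int)
  qed
  have small: "int i mod int m = int i" if "i < m" for i
    using that by simp
  have V: "knodel_V n = range (\<lambda>x. (1, nat (x mod int m))) \<union> range (\<lambda>x. (2, nat ((x + 3) mod int m)))"
  proof
    show "knodel_V n \<subseteq> range (\<lambda>x. (1, nat (x mod int m))) \<union> range (\<lambda>x. (2, nat ((x + 3) mod int m)))"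
    proof
      fix v assume "v \<in> knodel_V n"
      then obtain i j where v: "v = (i, j)" "i = 1 \<or> i = 2" "j < m" by (auto simp: knodel_V_def m_def)
      have "(1, j) = (\<lambda>x. (1, nat (x mod int m))) (int j)"
        "(2, j) = (\<lambda>x. (2, nat ((x + 3) mod int m))) (int j - 3)"
        using v(3) by simp_all
      then show "v \<in> range (\<lambda>x. (1, nat (x mod int m))) \<union> range (\<lambda>x. (2, nat ((x + 3) mod int m)))"
        using v by blast
    qed
    show "range (\<lambda>x. (1, nat (x mod int m))) \<union> range (\<lambda>x. (2, nat ((x + 3) mod int m))) \<subseteq> knodel_V n"
      using less by (auto simp: knodel_V_def m_def[symmetric])
  qed
  have adjA: "knodel_adj 4 n (1, nat (x mod int m)) w \<longleftrightarrow>
      w \<in> {(2, nat ((x - 3 + 3) mod int m)), (2, nat ((x - 2 + 3) mod int m)),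
        (2, nat ((x + 3) mod int m)), (2, nat ((x + 4 + 3) mod int m))}"
    for x w
  proof -
    have "knodel_adj 4 n (1, nat (x mod int m)) w
      \<longleftrightarrow> (\<exists>d\<in>{0, 1, 3, 7}. w = (2, nat ((x + int d) mod int m)))"
      unfolding knodel_adj_def knodel_edge_4 m_def[symmetric] prod_eq_iff fst_conv snd_conv shift
      using less[of x] by (simp only: simp_thms) auto
    also have "\<dots> \<longleftrightarrow> w = (2, nat ((x + int 0) mod int m)) \<or> w = (2, nat ((x + int 1) mod int m)) \<or>
        w = (2, nat ((x + int 3) mod int m)) \<or> w = (2, nat ((x + int 7) mod int m))"
      by (simp only: bex_simps simp_thms)
    also have "x + int 0 = x - 3 + 3" by simp
    also have "x + int 1 = x - 2 + 3" by simp
    also have "x + int 7 = x + 4 + 3" by simp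
    also have "x + int 3 = x + 3" by simp
    finally show ?thesis by (simp only: insert_iff empty_iff simp_thms)
  qed
  have adjB: "knodel_adj 4 n (2, nat ((x + 3) mod int m)) w \<longleftrightarrow>
      w \<in> {(1, nat ((x + 3) mod int m)),
        (1, nat ((x + 2) mod int m)), (1, nat (x mod int m)), (1, nat ((x - 4) mod int m))}"
    for x w
  proof -
    have inv: "i < m \<and> nat ((x + 3) mod int m) = (i + d) mod m
      \<longleftrightarrow> i = nat ((x + 3 - int d) mod int m)" for i d
    proof
      assume i: "i < m \<and> nat ((x + 3) mod int m) = (i + d) mod m"
      then have "nat ((x + 3) mod int m) = nat ((int i + int d) mod int m)"
        using shift[of "int i" d] small[of i] by (metis nat_int)
      then have "(x + 3) mod int m = (int i + int d) mod int m" by (simp only: nat_eq)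
      then have "(x + 3 - int d) mod int m = int i mod int m"
        using mod_add_cancel_int[of "x + 3 - int d" "int d" "int m"
          "int i"] by (simp only: diff_add_cancel simp_thms)
      then show "i = nat ((x + 3 - int d) mod int m)" using i small by (metis nat_int)
    next
      assume i: "i = nat ((x + 3 - int d) mod int m)"
      have "(i + d) mod m = nat ((x + 3) mod int m)"
        using shift[of "x + 3 - int d" d] unfolding i by (simp only: diff_add_cancel)
      then show "i < m \<and> nat ((x + 3) mod int m) = (i + d) mod m"
        using less unfolding i by metis
    qed
    have "knodel_adj 4 n (2, nat ((x + 3) mod int m)) w \<longleftrightarrow>
        (\<exists>d\<in>{0, 1, 3, 7}. fst w = 1 \<and> snd w < m \<and> nat ((x + 3) mod int m) = (snd w + d) mod m)"
      unfolding knodel_adj_def knodel_edge_4 m_def[symmetric] fst_conv snd_conv by auto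
    also have "\<dots> \<longleftrightarrow> (\<exists>d\<in>{0, 1, 3, 7}. w = (1, nat ((x + 3 - int d) mod int m)))"
      unfolding inv prod_eq_iff fst_conv snd_conv by (rule refl)
    also have "\<dots> \<longleftrightarrow> w = (1, nat ((x + 3 - int 0) mod int m)) \<or> w = (1, nat ((x + 3 - int 1) mod int m)) \<or>
        w = (1, nat ((x + 3 - int 3) mod int m)) \<or> w = (1, nat ((x + 3 - int 7) mod int m))"
      by (simp only: bex_simps simp_thms)
    also have "x + 3 - int 0 = x + 3" by simp
    also have "x + 3 - int 1 = x + 2" by simp
    also have "x + 3 - int 3 = x" by simp
    also have "x + 3 - int 7 = x - 4" by simp
    finally show ?thesis by (simp only: insert_iff empty_iff simp_thms)
  qed
  show ?thesis
    unfolding frame_def m_def[symmetric] V adjA adjB prod.inject nat_eq mod_add_cancel_int by simp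
qed

lemma frame_translate:
  assumes f: "frame n vA vB"
  shows "frame n (\<lambda>x. vA (x + k)) (\<lambda>x. vB (x + k))"
proof -
  have r: "range (\<lambda>x. v (x + k)) = range v" for v :: "int \<Rightarrow> nat \<times> nat"
  proof -
    have "v y \<in> range (\<lambda>x. v (x + k))" for y by (rule range_eqI[of _ _ "y - k"]) simp
    then show ?thesis by blast
  qed
  have e: "x + d + k = x + k + d" "x - d + k = x + k - d" for x d by simp_all
  show ?thesis
    unfolding frame_def r e frameD(1,2,4,5,6)[OF f] mod_add_cancel_int
    using frameD(3)[OF f] by simp
qed

text \<open>Seen from the other side the offsets change sign, so reversing the integers and
  exchanging the sides preserves adjacency.\<close>

lemma frame_reflect:
  assumes f: "frame n vA vB"
  shows "frame n (\<lambda>x. vB (k - x)) (\<lambda>x. vA (k - x))"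
proof -
  have r: "range (\<lambda>x. v (k - x)) = range v" for v :: "int \<Rightarrow> nat \<times> nat"
  proof -
    have "v y \<in> range (\<lambda>x. v (k - x))" for y by (rule range_eqI[of _ _ "k - y"]) simp
    then show ?thesis by blast
  qed
  have e: "k - (x - d) = k - x + d" "k - (x + d) = k - x - d" for x d by simp_all
  show ?thesis
    unfolding frame_def r e frameD(1,2,5,6)[OF f] mod_minus_cancel_int
    using frameD(3,4)[OF f] by (simp add: Un_commute eq_commute[of "vB _"])
qed

lemma frame_at:
  assumes "u \<in> knodel_V n" "0 < n div 2"
  obtains vA vB where "frame n vA vB" "vA x0 = u"
proof -
  obtain wA wB where f: "frame n wA wB" using frame_standard[OF assms(2)] by blast
  consider j where "u = wA j" | j where "u = wB j"
    using assms(1) frameD(4)[OF f] by blast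
  then show ?thesis
  proof cases
    case 1
    then show ?thesis by (intro that[OF frame_translate[OF f, of "j - x0"]]) simp
  next
    case 2
    then show ?thesis by (intro that[OF frame_reflect[OF f, of "j + x0"]]) simp
  qed
qed

lemma frame_excess:
  assumes "frame n vA vB"
  shows "vA x \<in> D \<or> (\<exists>d\<in>D. knodel_adj 4 n (vA x) d) \<longleftrightarrow>
      0 \<le> excessA (\<lambda>x. vA x \<in> D) (\<lambda>x. vB x \<in> D) x"
    and "vB x \<in> D \<or> (\<exists>d\<in>D. knodel_adj 4 n (vB x) d) \<longleftrightarrow>
      0 \<le> excessB (\<lambda>x. vA x \<in> D) (\<lambda>x. vB x \<in> D) x"
proof -
  have A: "knodel_adj 4 n (vA x) w \<longleftrightarrow> w \<in> {vB (x - 3), vB (x - 2), vB x, vB (x + 4)}"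
    and B: "knodel_adj 4 n (vB x) w \<longleftrightarrow> w \<in> {vA (x + 3), vA (x + 2), vA x, vA (x - 4)}" for w
    by (rule frameD[OF assms])+
  show "vA x \<in> D \<or> (\<exists>d\<in>D. knodel_adj 4 n (vA x) d) \<longleftrightarrow>
      0 \<le> excessA (\<lambda>x. vA x \<in> D) (\<lambda>x. vB x \<in> D) x"
    unfolding A by (auto simp: excessA_def of_bool_def)
  show "vB x \<in> D \<or> (\<exists>d\<in>D. knodel_adj 4 n (vB x) d) \<longleftrightarrow>
      0 \<le> excessB (\<lambda>x. vA x \<in> D) (\<lambda>x. vB x \<in> D) x"
    unfolding B by (auto simp: excessB_def of_bool_def)
qed

lemma frame_periodic:
  assumes "frame n vA vB"
  shows "periodic (n div 2) (\<lambda>x. vA x \<in> D)" "periodic (n div 2) (\<lambda>x. vB x \<in> D)"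
proof -
  have "vA (x + int (n div 2)) = vA x" "vB (x + int (n div 2)) = vB x" for x
    by (simp_all add: frameD(1,2)[OF assms])
  then show "periodic (n div 2) (\<lambda>x. vA x \<in> D)" "periodic (n div 2) (\<lambda>x. vB x \<in> D)"
    by (simp_all add: periodic_def)
qed

lemma frame_card:
  assumes f: "frame n vA vB" and m: "0 < n div 2" and D: "D \<subseteq> knodel_V n"
  shows "int (card D) = weight (n div 2) (\<lambda>x. vA x \<in> D) (\<lambda>x. vB x \<in> D)"
proof -
  define m where "m = n div 2"
  have m0: "0 < m" using m by (simp add: m_def)
  let ?I = "\<lambda>v. {..<m} \<inter> {i. v (int i) \<in> D}"
  let ?J = "\<lambda>v :: int \<Rightarrow> nat \<times> nat. (\<lambda>i. v (int i)) ` ?I v"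
  have rep: "vA x = vA (int (nat (x mod int m)))" "vB x = vB (int (nat (x mod int m)))"
    "nat (x mod int m) < m" for x
    using m0 by (simp_all add: frameD(1,2)[OF f] m_def[symmetric] nat_less_iff)
  have "D = ?J vA \<union> ?J vB"
  proof
    show "D \<subseteq> ?J vA \<union> ?J vB"
    proof
      fix v assume v: "v \<in> D"
      then consider x where "v = vA x" | x where "v = vB x" using D frameD(4)[OF f] by blast
      then show "v \<in> ?J vA \<union> ?J vB"
      proof cases
        case 1
        then have "v = vA (int (nat (x mod int m)))" using rep by simp
        then show ?thesis using v rep(3)[of x] by blast
      next
        case 2
        then have "v = vB (int (nat (x mod int m)))" using rep by simp
        then show ?thesis using v rep(3)[of x] by blast
      qed
    qed
  qed auto
  moreover have "?J vA \<inter> ?J vB = {}" using frameD(3)[OF f] by blast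
  moreover have "inj_on (\<lambda>i. vA (int i)) (?I vA)" "inj_on (\<lambda>i. vB (int i)) (?I vB)"
    by (auto simp: inj_on_def frameD(1,2)[OF f] m_def[symmetric])
  ultimately have "card D = card (?I vA) + card (?I vB)"
    by (metis (no_types, lifting) card_Un_disjoint card_image finite_Int finite_imageI finite_lessThan)
  then show ?thesis by (simp add: weight_def m_def sum.distrib)
qed

lemma dominating_covering:
  assumes "dominating (knodel_V n) (knodel_adj 4 n) D" "0 < n div 2"
  obtains a b where "covering (n div 2) a b" "weight (n div 2) a b = int (card D)"
proof -
  obtain vA vB where f: "frame n vA vB" using frame_standard[OF assms(2)] by blast
  have V: "vA x \<in> knodel_V n" "vB x \<in> knodel_V n" for x using frameD(4)[OF f] by blast+
  have D: "D \<subseteq> knodel_V n" using assms(1) by (simp add: dominating_def)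
  have dom: "v \<in> D \<or> (\<exists>d\<in>D. knodel_adj 4 n v d)" if "v \<in> knodel_V n" for v
    using assms(1) that unfolding dominating_def by blast
  have "covering (n div 2) (\<lambda>x. vA x \<in> D) (\<lambda>x. vB x \<in> D)"
    unfolding covering_def frame_excess[OF f, symmetric]
    using frame_periodic[OF f] dom[OF V(1)] dom[OF V(2)] by blast
  then show ?thesis by (rule that) (rule frame_card[OF f assms(2) D, symmetric])
qed

lemma dominating_covering_but_0:
  assumes "dominating (knodel_V n - {u}) (knodel_adj 4 n) D" "u \<in> knodel_V n" "0 < n div 2"
  obtains a b where "covering_but_0 (n div 2) a b" "weight (n div 2) a b = int (card D)"
proof -
  obtain vA vB where f: "frame n vA vB" and u: "vA 0 = u" using frame_at[OF assms(2,3), of 0] by blast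
  have D: "D \<subseteq> knodel_V n" using assms(1) by (auto simp: dominating_def)
  have dom: "v \<in> D \<or> (\<exists>d\<in>D. knodel_adj 4 n v d)" if "v \<in> knodel_V n - {u}" for v
    using assms(1) that unfolding dominating_def by blast
  have V: "vB x \<in> knodel_V n - {u}" for x
    using frameD(3)[OF f, of 0 x] frameD(4)[OF f] u by simp
  have VA: "vA x \<in> knodel_V n - {u}" if "\<not> int (n div 2) dvd x" for x
  proof -
    have "vA x \<noteq> vA 0" using that by (simp add: frameD(1)[OF f] dvd_eq_mod_eq_0)
    then show ?thesis using frameD(4)[OF f] u by simp
  qed
  have "covering_but_0 (n div 2) (\<lambda>x. vA x \<in> D) (\<lambda>x. vB x \<in> D)"
    unfolding covering_but_0_def frame_excess[OF f, symmetric]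
    by (intro conjI allI impI frame_periodic[OF f] dom VA V)
  then show ?thesis by (rule that) (rule frame_card[OF f assms(3) D, symmetric])
qed

text \<open>Position \<open>x0\<close> is put on the deleted vertex. As \<open>a x0\<close> fails, D
  avoids that vertex; if \<open>x0\<close> is dominated too, the same D serves the full
  graph.\<close>

lemma dominating_of_sequences:
  assumes a: "periodic (n div 2) a" and b: "periodic (n div 2) b" and u: "u \<in> knodel_V n" "0 < n div 2"
    and x0: "\<not> a x0"
    and exA: "\<And>x. x mod int (n div 2) \<noteq> x0 mod int (n div 2) \<Longrightarrow> 0 \<le> excessA a b x"
    and exB: "\<And>x. 0 \<le> excessB a b x"
  obtains D where "dominating (knodel_V n - {u}) (knodel_adj 4 n) D"
    "int (card D) = weight (n div 2) a b"
    "0 \<le> excessA a b x0 \<Longrightarrow> dominating (knodel_V n) (knodel_adj 4 n) D"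
proof -
  obtain vA vB where f: "frame n vA vB" and u: "vA x0 = u" using frame_at[OF u, of x0] by blast
  define D where "D = vA ` {x. a x} \<union> vB ` {x. b x}"
  have memA: "vA x \<in> D \<longleftrightarrow> a x" for x
  proof -
    have "vA x = vA y \<Longrightarrow> a y \<Longrightarrow> a x" for y
      using frameD(1)[OF f] periodic_cong[OF a, of x y] by blast
    moreover have "vA x \<noteq> vB y" for y by (rule frameD(3)[OF f])
    ultimately show ?thesis unfolding D_def by blast
  qed
  have memB: "vB x \<in> D \<longleftrightarrow> b x" for x
  proof -
    have "vB x = vB y \<Longrightarrow> b y \<Longrightarrow> b x" for y
      using frameD(2)[OF f] periodic_cong[OF b, of x y] by blast
    moreover have "vB x \<noteq> vA y" for y using frameD(3)[OF f] by metis
    ultimately show ?thesis unfolding D_def by blast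
  qed
  have D: "D \<subseteq> knodel_V n" using frameD(4)[OF f] unfolding D_def by blast
  have domA: "vA x \<in> D \<or> (\<exists>d\<in>D. knodel_adj 4 n (vA x) d)" if "0 \<le> excessA a b x" for x
    using frame_excess(1)[OF f, of x D] that by (simp add: memA memB)
  have domB: "vB x \<in> D \<or> (\<exists>d\<in>D. knodel_adj 4 n (vB x) d)" for x
    using frame_excess(2)[OF f, of x D] exB by (simp add: memA memB)
  have eq: "vA x = u \<longleftrightarrow> x mod int (n div 2) = x0 mod int (n div 2)" for x
    using frameD(1)[OF f, of x x0] u by simp
  have V: "v \<in> range vA \<union> range vB" if "v \<in> knodel_V n" for v
    using frameD(4)[OF f] that by blast
  have uD: "u \<notin> D" using memA[of x0] x0 u by simp
  show ?thesis
  proof (rule that)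
    have "v \<in> D \<or> (\<exists>d\<in>D. knodel_adj 4 n v d)" if v: "v \<in> knodel_V n - {u}" for v
    proof -
      consider x where "v = vA x" "x mod int (n div 2) \<noteq> x0 mod int (n div 2)" | x where "v = vB x"
        using V[of v] v eq by blast
      then show ?thesis by cases (use domA exA domB in auto)
    qed
    then show "dominating (knodel_V n - {u}) (knodel_adj 4 n) D"
      unfolding dominating_def using D uD by blast
    show "int (card D) = weight (n div 2) a b"
      using frame_card[OF f assms(4) D] by (simp add: memA memB)
    assume z: "0 \<le> excessA a b x0"
    have "0 \<le> excessA a b x" for x
      using exA[of x] z periodic_cong[OF periodic_excessA[OF a b], of x x0] by metis
    then have "v \<in> D \<or> (\<exists>d\<in>D. knodel_adj 4 n v d)" if "v \<in> knodel_V n" for v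
      using V[OF that] domA domB by auto
    then show "dominating (knodel_V n) (knodel_adj 4 n) D"
      unfolding dominating_def using D by blast
  qed
qed

section \<open>Domination numbers and criteria for stability\<close>

lemma finite_knodel_V: "finite (knodel_V n)"
proof -
  have "knodel_V n \<subseteq> {1, 2} \<times> {..<n div 2}" by (auto simp: knodel_V_def)
  then show ?thesis by (rule finite_subset) simp
qed

lemma card_knodel_V: "card (knodel_V n) = 2 * (n div 2)"
proof -
  have "knodel_V n = {1, 2} \<times> {..<n div 2}" by (auto simp: knodel_V_def)
  then show ?thesis by (simp add: card_cartesian_product)
qed

lemma domination_number_le:
  assumes "finite V" "dominating V E D"
  shows "domination_number V E \<le> card D"
  unfolding domination_number_def
proof (rule Min_le)
  have "{card D | D. dominating V E D} \<subseteq> {..card V}"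
    using assms(1) by (auto simp: dominating_def intro: card_mono)
  then show "finite {card D | D. dominating V E D}" by (rule finite_subset) simp
qed (use assms in auto)

lemma domination_number_attained:
  assumes "finite V"
  obtains D where "dominating V E D" "card D = domination_number V E"
proof -
  have "{card D | D. dominating V E D} \<subseteq> {..card V}"
    using assms by (auto simp: dominating_def intro: card_mono)
  then have fin: "finite {card D | D. dominating V E D}" by (rule finite_subset) simp
  have "dominating V E V" by (simp add: dominating_def)
  then have "{card D | D. dominating V E D} \<noteq> {}" by blast
  from Min_in[OF fin this] show ?thesis using that unfolding domination_number_def by auto
qed

text \<open>Supersets of dominating sets dominate, so a bound on the domination number gives a set
  of exactly the size that the searches exclude.\<close>

lemma dominating_of_card:
  assumes V: "finite V" and "domination_number V E \<le> k" "k \<le> card V"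
  obtains D where "dominating V E D" "card D = k"
proof -
  obtain D where D: "dominating V E D" "card D = domination_number V E"
    using domination_number_attained[OF V] by blast
  then have "D \<subseteq> V" by (simp add: dominating_def)
  then obtain D' where "D \<subseteq> D'" "D' \<subseteq> V" "card D' = k"
    using exists_subset_between[of D k V] assms D by auto
  moreover from this have "dominating V E D'" using D unfolding dominating_def by blast
  ultimately show ?thesis by (intro that)
qed

text \<open>One set of size k + 1 dominates the graph and also the graph without \<open>u\<close>,
  while no k vertices suffice after any deletion. So both numbers are k + 1.\<close>

lemma gamma_stableI:
  assumes n: "0 < n div 2" and c: "covering (n div 2) a b" and x0: "\<not> a x0"
    and w: "weight (n div 2) a b = int (Suc k)" and k: "Suc k \<le> n div 2"
    and none: "\<And>a b. covering_but_0 (n div 2) a b \<Longrightarrow> weight (n div 2) a b \<noteq> int k"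
  shows "gamma_stable (knodel_V n) (knodel_adj 4 n)"
  unfolding gamma_stable_def
proof
  fix u assume u: "u \<in> knodel_V n"
  let ?V = "knodel_V n" and ?E = "knodel_adj 4 n"
  have lower: "k < domination_number (?V - {v}) ?E" if v: "v \<in> ?V" for v
  proof (rule ccontr)
    assume "\<not> ?thesis"
    then have "domination_number (?V - {v}) ?E \<le> k" by simp
    moreover have "k \<le> card (?V - {v})" using k v by (simp add: card_knodel_V finite_knodel_V)
    ultimately obtain D where "dominating (?V - {v}) ?E D" "card D = k"
      using dominating_of_card[of "?V - {v}"] finite_knodel_V by blast
    then show False using dominating_covering_but_0[OF _ v n] none by metis
  qed
  obtain D where D: "dominating (?V - {u}) ?E D" "int (card D) = weight (n div 2) a b"
    "dominating ?V ?E D"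
    using dominating_of_sequences[of n a b u x0] c u n x0 unfolding covering_def by blast
  have card: "card D = Suc k" using D w by simp
  have "domination_number (?V - {u}) ?E \<le> Suc k"
    using domination_number_le[OF _ D(1)] card finite_knodel_V by simp
  moreover have "domination_number ?V ?E \<le> Suc k"
    using domination_number_le[OF _ D(3)] card finite_knodel_V by simp
  moreover have "k < domination_number ?V ?E"
  proof (rule ccontr)
    assume "\<not> ?thesis"
    moreover have "k \<le> card ?V" using k card_knodel_V[of n] by simp
    ultimately obtain C where C: "dominating ?V ?E C" "card C = k"
      using dominating_of_card[OF finite_knodel_V, of n ?E k] by auto
    \<comment> \<open>A dominating set of size k misses some vertex and then also dominates the
      graph without it.\<close>
    then have "C \<noteq> ?V" using k card_knodel_V[of n] by auto
    then obtain v where v: "v \<in> ?V" "v \<notin> C" using C by (auto simp: dominating_def)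
    then have "dominating (?V - {v}) ?E C" using C by (auto simp: dominating_def)
    then have "domination_number (?V - {v}) ?E \<le> k"
      using domination_number_le[of "?V - {v}"] C finite_knodel_V by fastforce
    then show False using lower[OF v(1)] by simp
  qed
  ultimately show "domination_number (?V - {u}) ?E = domination_number ?V ?E"
    using lower[OF u] by simp
qed

text \<open>Deleting a vertex placed at \<open>x0\<close> leaves a graph dominated by k vertices,
  whereas the full graph needs more.\<close>

lemma not_gamma_stableI:
  assumes n: "0 < n div 2" and a: "periodic (n div 2) a" and b: "periodic (n div 2) b" and x0: "\<not> a x0"
    and exA: "\<And>x. x mod int (n div 2) \<noteq> x0 mod int (n div 2) \<Longrightarrow> 0 \<le> excessA a b x"
    and exB: "\<And>x. 0 \<le> excessB a b x"
    and w: "weight (n div 2) a b = int k" and k: "k \<le> n div 2"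
    and none: "\<And>a b. covering (n div 2) a b \<Longrightarrow> weight (n div 2) a b \<noteq> int k"
  shows "\<not> gamma_stable (knodel_V n) (knodel_adj 4 n)"
proof
  let ?V = "knodel_V n" and ?E = "knodel_adj 4 n"
  assume stable: "gamma_stable ?V ?E"
  have u: "(1, 0) \<in> ?V" using n by (simp add: knodel_V_def)
  obtain D where "dominating (?V - {(1, 0)}) ?E D" "int (card D) = weight (n div 2) a b"
    using dominating_of_sequences[OF a b u n x0 exA exB] by blast
  then have "domination_number (?V - {(1, 0)}) ?E \<le> k"
    using domination_number_le[of "?V - {(1, 0)}"] finite_knodel_V w by (metis finite_Diff of_nat_eq_iff)
  then have "domination_number ?V ?E \<le> k" using stable u unfolding gamma_stable_def by auto
  moreover have "k \<le> card ?V" using k card_knodel_V[of n] by simp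
  ultimately obtain C where C: "dominating ?V ?E C" "card C = k"
    using dominating_of_card[OF finite_knodel_V, of n ?E k] by auto
  then show False using dominating_covering[OF _ n] none by metis
qed

section \<open>Optimal dominating sets\<close>

text \<open>The perfect code with period 5, cut open between m - 1 and 0. One vertex stays undominated if r is
  1 or 4.\<close>

definition blockA :: "nat \<Rightarrow> int \<Rightarrow> bool" where
  "blockA m x \<longleftrightarrow> x mod int m mod 5 = 0 \<or> 3 \<le> m mod 5 \<and> x mod int m = int m - 1"

definition blockB :: "nat \<Rightarrow> int \<Rightarrow> bool" where
  "blockB m x \<longleftrightarrow> x mod int m mod 5 = 1"

lemma periodic_block: "periodic m (blockA m)" "periodic m (blockB m)"
  by (simp_all add: periodic_def blockA_def blockB_def)

lemma excess_nonneg_iff: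
  "0 \<le> excessA a b x \<longleftrightarrow> a x \<or> b (x - 3) \<or> b (x - 2) \<or> b x \<or> b (x + 4)"
  "0 \<le> excessB a b x \<longleftrightarrow> b x \<or> a (x + 3) \<or> a (x + 2) \<or> a x \<or> a (x - 4)"
  by (auto simp: excessA_def excessB_def of_bool_def)

lemma block_values:
  assumes "0 \<le> z" "z < int m"
  shows "blockA m z \<longleftrightarrow> z mod 5 = 0 \<or> 3 \<le> m mod 5 \<and> z = int m - 1"
    and "blockB m z \<longleftrightarrow> z mod 5 = 1"
    and "blockA m (int m + z) \<longleftrightarrow> z mod 5 = 0 \<or> 3 \<le> m mod 5 \<and> z = int m - 1"
    and "blockB m (int m + z) \<longleftrightarrow> z mod 5 = 1"
proof -
  have "z mod int m = z" "(int m + z) mod int m = z" using assms by simp_all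
  then show "blockA m z \<longleftrightarrow> z mod 5 = 0 \<or> 3 \<le> m mod 5 \<and> z = int m - 1"
    and "blockB m z \<longleftrightarrow> z mod 5 = 1"
    and "blockA m (int m + z) \<longleftrightarrow> z mod 5 = 0 \<or> 3 \<le> m mod 5 \<and> z = int m - 1"
    and "blockB m (int m + z) \<longleftrightarrow> z mod 5 = 1"
    unfolding blockA_def blockB_def by simp_all
qed

text \<open>Only residue 2 relies on a later column, z + 4. Behind the seam this is a code column
  again for remainder 0, the extra vertex helps for remainder 3, and remainders 1 and 4 give the
  exempt vertices.\<close>

lemma block_excessA:
  assumes m: "8 \<le> m" and x: "\<not> (m mod 5 = 1 \<and> x mod int m = int m - 4)"
    "\<not> (m mod 5 = 4 \<and> x mod int m = int m - 2)"
  shows "0 \<le> excessA (blockA m) (blockB m) x"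
proof -
  define z where "z = x mod int m"
  have z: "0 \<le> z" "z < int m" using m by (simp_all add: z_def)
  have mi: "int (m mod 5) = int m mod 5" by (simp add: of_nat_mod)
  consider "z mod 5 = 0" | "z mod 5 = 1" | "z mod 5 = 2" "z + 4 < int m" | "z mod 5 = 2" "int m \<le> z + 4"
    | "z mod 5 = 3" | "z mod 5 = 4" by linarith
  then have "0 \<le> excessA (blockA m) (blockB m) z"
  proof cases
    case 1
    then show ?thesis using z by (simp add: excess_nonneg_iff block_values)
  next
    case 2
    then show ?thesis using z by (simp add: excess_nonneg_iff block_values)
  next
    case 3
    then have "(z + 4) mod 5 = 1" by presburger
    then show ?thesis using z 3 by (simp add: excess_nonneg_iff block_values)
  next
    case 4
    then have "z = int m - 1 \<and> int m mod 5 = 3 \<or> z = int m - 2 \<and> int m mod 5 = 4 \<or>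
        z = int m - 3 \<and> int m mod 5 = 0 \<or> z = int m - 4 \<and> int m mod 5 = 1"
      using z by presburger
    then consider "z = int m - 1" "m mod 5 = 3" | "z = int m - 3" "m mod 5 = 0"
      using x mi unfolding z_def[symmetric] by linarith
    then show ?thesis
    proof cases
      case 1
      then show ?thesis using z by (simp add: excess_nonneg_iff block_values)
    next
      case 2
      then have e: "z + 4 = int m + 1" by simp
      have "blockB m (z + 4)" unfolding e using block_values(4)[of 1 m] m by simp
      then show ?thesis unfolding excess_nonneg_iff by blast
    qed
  next
    case 5
    then have "(z - 2) mod 5 = 1" "0 \<le> z - 2" using z by presburger+
    then show ?thesis using z by (simp add: excess_nonneg_iff block_values)
  next
    case 6
    then have "(z - 3) mod 5 = 1" "0 \<le> z - 3" using z by presburger+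
    then show ?thesis using z by (simp add: excess_nonneg_iff block_values)
  qed
  then show ?thesis
    unfolding z_def periodic_mod[OF periodic_excessA[OF periodic_block]] .
qed

text \<open>Residues 2 and 3 rely on the columns z + 3 and z + 2. At the seam, column m, a copy of
  column 0, or the extra vertex at m - 1 takes over.\<close>

lemma block_excessB:
  assumes m: "8 \<le> m"
  shows "0 \<le> excessB (blockA m) (blockB m) x"
proof -
  define z where "z = x mod int m"
  have z: "0 \<le> z" "z < int m" using m by (simp_all add: z_def)
  have mi: "int (m mod 5) = int m mod 5" by (simp add: of_nat_mod)
  have zero: "blockA m (int m)" using block_values(3)[of 0 m] m by simp
  consider "z mod 5 = 0" | "z mod 5 = 1" | "z mod 5 = 2" "z + 3 < int m" | "z mod 5 = 2" "int m \<le> z + 3"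
    | "z mod 5 = 3" "z + 2 < int m" | "z mod 5 = 3" "int m \<le> z + 2" | "z mod 5 = 4" by linarith
  then have "0 \<le> excessB (blockA m) (blockB m) z"
  proof cases
    case 1
    then show ?thesis using z by (simp add: excess_nonneg_iff block_values)
  next
    case 2
    then show ?thesis using z by (simp add: excess_nonneg_iff block_values)
  next
    case 3
    then have "(z + 3) mod 5 = 0" by presburger
    then show ?thesis using z 3 by (simp add: excess_nonneg_iff block_values)
  next
    case 4
    then have "z = int m - 1 \<and> int m mod 5 = 3 \<or> z + 2 = int m \<or> z + 3 = int m"
      using z by presburger
    then consider "z = int m - 1" "m mod 5 = 3" | "z + 2 = int m" | "z + 3 = int m"
      using mi by linarith
    then show ?thesis
    proof cases
      case 1
      then show ?thesis using z by (simp add: excess_nonneg_iff block_values)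
    qed (use zero in \<open>simp_all add: excess_nonneg_iff\<close>)
  next
    case 5
    then have "(z + 2) mod 5 = 0" by presburger
    then show ?thesis using z 5 by (simp add: excess_nonneg_iff block_values)
  next
    case 6
    then have "z = int m - 1 \<and> int m mod 5 = 4 \<or> z + 2 = int m"
      using z by presburger
    then consider "z = int m - 1" "m mod 5 = 4" | "z + 2 = int m"
      using mi by linarith
    then show ?thesis
    proof cases
      case 1
      then show ?thesis using z by (simp add: excess_nonneg_iff block_values)
    qed (use zero in \<open>simp add: excess_nonneg_iff\<close>)
  next
    case 7
    then have "(z - 4) mod 5 = 0" "0 \<le> z - 4" using z by presburger+
    then show ?thesis using z by (simp add: excess_nonneg_iff block_values)
  qed
  then show ?thesis
    unfolding z_def periodic_mod[OF periodic_excessB[OF periodic_block]] .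
qed

lemma weight_block:
  assumes m: "m = 5 * q + r" "r < 5"
  shows "weight m (blockA m) (blockB m) = 2 * int q + of_bool (1 \<le> r) + of_bool (2 \<le> r)
    + of_bool (3 \<le> r)"
proof -
  have r: "m mod 5 = r" using m by simp
  define f where "f = (\<lambda>i. of_bool (i mod 5 = 0 \<or> 3 \<le> r \<and> Suc i = m) + of_bool (i mod 5 = 1) :: int)"
  have "weight m (blockA m) (blockB m) = (\<Sum>i<m. f i)"
    unfolding weight_def
  proof (rule sum.cong)
    fix i assume "i \<in> {..<m}"
    then have "0 \<le> int i" "int i < int m" by simp_all
    note v = block_values[OF this]
    have "int i mod 5 = 0 \<longleftrightarrow> i mod 5 = 0" "int i mod 5 = 1 \<longleftrightarrow> i mod 5 = 1" by presburger+
    moreover have "int i = int m - 1 \<longleftrightarrow> Suc i = m" by linarith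
    ultimately show "of_bool (blockA m (int i)) + of_bool (blockB m (int i)) = f i"
      unfolding f_def v r by simp
  qed simp
  also have "\<dots> = (\<Sum>i<5 * q. f i) + (\<Sum>j<r. f (5 * q + j))"
    unfolding m(1) by (induction r) simp_all
  also have "(\<Sum>i<5 * q. f i) = (\<Sum>i<5 * q. of_bool (i mod 5 = 0) + of_bool (i mod 5 = 1))"
    using m by (intro sum.cong) (auto simp: f_def)
  also have "\<dots> = 2 * int q"
  proof (induction q)
    case (Suc q)
    have five: "5 * Suc q = Suc (Suc (Suc (Suc (Suc (5 * q)))))" by simp
    have mods: "5 * q mod 5 = 0" "Suc (5 * q) mod 5 = 1" "Suc (Suc (5 * q)) mod 5 = 2"
      "Suc (Suc (Suc (5 * q))) mod 5 = 3" "Suc (Suc (Suc (Suc (5 * q)))) mod 5 = 4" by presburger+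
    show ?case unfolding five sum.lessThan_Suc mods Suc.IH by simp
  qed simp
  also have "(\<Sum>j<r. f (5 * q + j)) = of_bool (1 \<le> r) + of_bool (2 \<le> r) + of_bool (3 \<le> r)"
  proof -
    have f: "f (5 * q + j) = of_bool (j = 0 \<or> 3 \<le> r \<and> Suc j = r) + of_bool (j = 1)" if "j < r" for j
      using that m by (auto simp: f_def)
    have "(\<Sum>j<r. f (5 * q + j)) = (\<Sum>j<r. of_bool (j = 0 \<or> 3 \<le> r \<and> Suc j = r) + of_bool (j = 1))"
      by (rule sum.cong) (simp_all add: f)
    also have "\<dots> = of_bool (1 \<le> r) + of_bool (2 \<le> r) + of_bool (3 \<le> r)"
    proof -
      have "r \<in> {0, 1, 2, 3, 4}" using m(2) by auto
      then show ?thesis by (auto simp: numeral_eq_Suc)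
    qed
    finally show ?thesis .
  qed
  finally show ?thesis by simp
qed

lemma covering_block:
  assumes "8 \<le> m" "m mod 5 \<noteq> 1" "m mod 5 \<noteq> 4"
  shows "covering m (blockA m) (blockB m)"
  using assms by (simp add: covering_def periodic_block block_excessA block_excessB)

section \<open>Sporadic sets for small periods\<close>

definition cyclic :: "nat \<Rightarrow> int list \<Rightarrow> int \<Rightarrow> bool" where
  "cyclic m xs x \<longleftrightarrow> x mod int m \<in> set xs"

lemma periodic_cyclic: "periodic m (cyclic m xs)"
  by (simp add: periodic_def cyclic_def)

definition sporadic :: "nat \<Rightarrow> int list \<Rightarrow> int list \<Rightarrow> int list \<Rightarrow> bool" where
  "sporadic m xs ys zs \<longleftrightarrow>
     list_all (\<lambda>z. z \<in> set zs \<or> 0 \<le> excessA (cyclic m xs) (cyclic m ys) z) [0..int m - 1] \<and>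
     list_all (\<lambda>z. 0 \<le> excessB (cyclic m xs) (cyclic m ys) z) [0..int m - 1]"

lemma sporadicD:
  assumes "sporadic m xs ys zs" "0 < m"
  shows "x mod int m \<notin> set zs \<Longrightarrow> 0 \<le> excessA (cyclic m xs) (cyclic m ys) x"
    and "0 \<le> excessB (cyclic m xs) (cyclic m ys) x"
proof -
  have x: "x mod int m \<in> {0..int m - 1}" using assms(2) by simp
  note p = periodic_mod[OF periodic_excessA[OF periodic_cyclic periodic_cyclic], of m xs ys x]
    periodic_mod[OF periodic_excessB[OF periodic_cyclic periodic_cyclic], of m xs ys x]
  show "0 \<le> excessB (cyclic m xs) (cyclic m ys) x"
    using assms(1) x p(2) unfolding sporadic_def list_all_iff set_upto by metis
  assume "x mod int m \<notin> set zs"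
  then show "0 \<le> excessA (cyclic m xs) (cyclic m ys) x"
    using assms(1) x p(1) unfolding sporadic_def list_all_iff set_upto by metis
qed

text \<open>For m = 8, 9, 18 these sets have one element fewer than the block. For m = 14 the size
  is the same, but nothing stays undominated; for m = 13 one element is saved at the price of
  position 12.\<close>

lemma sporadic_sets:
  "sporadic 8 [0, 1] [2, 3] []" "sporadic 9 [0, 1] [2, 3] []"
  "sporadic 13 [0, 1, 5] [6, 7, 8] [12]" "sporadic 14 [0, 1, 5] [6, 7, 8, 10] []"
  "sporadic 18 [0, 1, 9, 10] [2, 3, 11, 12] []"
  by code_simp+

lemma sporadic_weights:
  "weight 8 (cyclic 8 [0, 1]) (cyclic 8 [2, 3]) = 4"
  "weight 9 (cyclic 9 [0, 1]) (cyclic 9 [2, 3]) = 4"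
  "weight 13 (cyclic 13 [0, 1, 5]) (cyclic 13 [6, 7, 8]) = 6"
  "weight 14 (cyclic 14 [0, 1, 5]) (cyclic 14 [6, 7, 8, 10]) = 7"
  "weight 18 (cyclic 18 [0, 1, 9, 10]) (cyclic 18 [2, 3, 11, 12]) = 8"
  by code_simp+

lemma gamma_stable_sporadic:
  assumes n: "n div 2 = m" "0 < m" and s: "sporadic m xs ys []"
    and w: "weight m (cyclic m xs) (cyclic m ys) = int (Suc k)" "Suc k \<le> m" and x0: "\<not> cyclic m xs x0"
    and none: "\<And>a b. covering_but_0 m a b \<Longrightarrow> weight m a b \<noteq> int k"
  shows "gamma_stable (knodel_V n) (knodel_adj 4 n)"
proof -
  have "covering m (cyclic m xs) (cyclic m ys)"
    using sporadicD[OF s n(2)] by (simp add: covering_def periodic_cyclic)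
  then show ?thesis using gamma_stableI[of n _ _ x0 k] assms by simp
qed

theorem theorem4p6:
  fixes n :: nat
  assumes "even n" and "n \<ge> 16"
  shows "gamma_stable (knodel_V n) (knodel_adj 4 n) \<longleftrightarrow>
           (n \<in> {18, 28} \<or> n mod 10 = 0 \<or> n mod 10 = 4 \<or> (n \<noteq> 26 \<and> n mod 10 = 6))"
proof -
  define m where "m = n div 2"
  define q where "q = m div 5"
  define r where "r = m mod 5"
  have n: "n = 2 * m" and m8: "8 \<le> m" using assms by (simp_all add: m_def)
  have m: "m = 5 * q + r" "r < 5" by (simp_all add: q_def r_def)
  have n10: "n mod 10 = 2 * r" using n m by presburger
  have m0: "0 < n div 2" using m8 by (simp add: m_def)
  \<comment> \<open>Position 2 lies outside the A part of the block for every m in question, so the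
    deleted vertex can be put there.\<close>
  have x2: "\<not> blockA m 2" using block_values(1)[of 2 m] m8 by simp
  note weight = weight_block[OF m]
  have stable: "gamma_stable (knodel_V n) (knodel_adj 4 n)"
    if "r \<noteq> 1" "r \<noteq> 4" "weight m (blockA m) (blockB m) = int (Suc k)"
      "\<And>a b. covering_but_0 m a b \<Longrightarrow> weight m a b \<noteq> int k" "Suc k \<le> m" for k
    using gamma_stableI[OF m0, of "blockA m" "blockB m" 2 k] covering_block[OF m8] that x2
    by (simp add: m_def[symmetric] r_def)
  consider "r = 0" | "r = 1" | "r = 2" | "r = 3" | "r = 4" using m(2) by linarith
  then show ?thesis
  proof cases
    assume r: "r = 0"
    have q: "2 \<le> q" using m8 m r by simp
    have "gamma_stable (knodel_V n) (knodel_adj 4 n)"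
    proof (rule stable[of "2 * q - 1"])
      fix a b
      assume "covering_but_0 m a b"
      from covering_but_0_weight[OF this] show "weight m a b \<noteq> int (2 * q - 1)"
        using m r q by auto
    qed (use r q m weight in auto)
    then show ?thesis using n10 r by simp
  next
    assume r: "r = 1"
    have m11: "m = 5 * q + 1" "11 \<le> m" using m8 m r by presburger+
    have "\<not> gamma_stable (knodel_V n) (knodel_adj 4 n)"
    \<comment> \<open>For remainder 1 the block leaves exactly position m - 4 exempt.\<close>
    proof (rule not_gamma_stableI[OF m0, of "blockA m" "blockB m" "int m - 4" "2 * q + 1", folded m_def])
      show "\<not> blockA m (int m - 4)"
        using block_values(1)[of "int m - 4" m] m11 by simp presburger
      have e: "(int m - 4) mod int m = int m - 4" using m8 by (intro mod_pos_pos_trivial) auto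
      show "0 \<le> excessA (blockA m) (blockB m) x" if "x mod int m \<noteq> (int m - 4) mod int m" for x
        using that[unfolded e] m8 r by (intro block_excessA) (auto simp: r_def)
      show "weight m a b \<noteq> int (2 * q + 1)" if "covering m a b" for a b
        using no_covering_1[OF that m11] by simp
    qed (use weight r m m8 in \<open>auto simp: periodic_block block_excessB\<close>)
    moreover have "n \<noteq> 18" "n \<noteq> 28" using n10 r by auto
    ultimately show ?thesis using n10 r by simp
  next
    assume r: "r = 2"
    have m12: "m = 5 * q + 2" "12 \<le> m" using m8 m r by presburger+
    have "gamma_stable (knodel_V n) (knodel_adj 4 n)"
    proof (rule stable[of "2 * q + 1"])
      show "weight m a b \<noteq> int (2 * q + 1)" if "covering_but_0 m a b" for a b
        using no_deletion_2[OF that m12] by simp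
    qed (use r m m8 weight in auto)
    then show ?thesis using n10 r by simp
  next
    assume r: "r = 3"
    have "m = 8 \<or> m = 13 \<or> m = 18 \<or> 23 \<le> m" using m m8 r by presburger
    then consider "m = 8" | "m = 13" | "m = 18" | "23 \<le> m" by blast
    then show ?thesis
    proof cases
      assume m: "m = 8"
      have "gamma_stable (knodel_V n) (knodel_adj 4 n)"
        using gamma_stable_sporadic[of n 8 "[0, 1]"
          "[2, 3]" 3 2] no_deletion_8 sporadic_sets(1) sporadic_weights(1) m
        by (simp add: m_def cyclic_def)
      then show ?thesis using n m by simp
    next
      \<comment> \<open>Six vertices suffice after a deletion, but by \<open>no_covering_13\<close>
        not for the full graph.\<close>
      assume m: "m = 13"
      have n13: "n div 2 = 13" using m by (simp add: m_def)
      note D = sporadicD[OF sporadic_sets(3)]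
      have "\<not> gamma_stable (knodel_V n) (knodel_adj 4 n)"
        by (rule not_gamma_stableI[OF m0, of "cyclic 13 [0, 1, 5]"
          "cyclic 13 [6, 7, 8]" 12 6, unfolded n13])
          (use D no_covering_13 sporadic_weights(3) in \<open>auto simp: periodic_cyclic cyclic_def\<close>)
      then show ?thesis using n m by simp
    next
      assume m: "m = 18"
      have "gamma_stable (knodel_V n) (knodel_adj 4 n)"
        using gamma_stable_sporadic[of n 18 "[0, 1, 9, 10]"
          "[2, 3, 11, 12]" 7 2] no_deletion_18 sporadic_sets(5) sporadic_weights(5) m
        by (simp add: m_def cyclic_def)
      then show ?thesis using n m by simp
    next
      assume m23: "23 \<le> m"
      have m3: "m = 5 * q + 3" using m r by simp
      have "gamma_stable (knodel_V n) (knodel_adj 4 n)"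
      proof (rule stable[of "2 * q + 2"])
        show "weight m a b \<noteq> int (2 * q + 2)" if "covering_but_0 m a b" for a b
          using no_deletion_3[OF that m3 m23] by simp
      qed (use r m m8 weight in auto)
      moreover have "n \<noteq> 26" using n m23 by simp
      ultimately show ?thesis using n10 r by simp
    qed
  next
    assume r: "r = 4"
    have "m = 9 \<or> m = 14 \<or> 19 \<le> m" using m m8 r by presburger
    then consider "m = 9" | "m = 14" | "19 \<le> m" by blast
    then show ?thesis
    proof cases
      assume m: "m = 9"
      \<comment> \<open>Weight 3 would give total excess 15 - 18, which is below -1.\<close>
      have "weight 9 a b \<noteq> 3" if "covering_but_0 9 a b" for a b
        using covering_but_0_weight[OF that] by auto
      then have "gamma_stable (knodel_V n) (knodel_adj 4 n)"
        using gamma_stable_sporadic[of n 9 "[0, 1]" "[2, 3]" 3 2] sporadic_sets(2) sporadic_weights(2) m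
        by (simp add: m_def cyclic_def)
      then show ?thesis using n m by simp
    next
      assume m: "m = 14"
      have "gamma_stable (knodel_V n) (knodel_adj 4 n)"
        using gamma_stable_sporadic[of n 14 "[0, 1, 5]"
          "[6, 7, 8, 10]" 6 2] no_deletion_14 sporadic_sets(4) sporadic_weights(4) m
        by (simp add: m_def cyclic_def)
      then show ?thesis using n m by simp
    next
      assume m19: "19 \<le> m"
      have m4: "m = 5 * q + 4" using m r by simp
      have "\<not> gamma_stable (knodel_V n) (knodel_adj 4 n)"
      proof (rule not_gamma_stableI[OF m0, of "blockA m" "blockB m" "int m - 2"
        "2 * q + 3", folded m_def])
        show "\<not> blockA m (int m - 2)"
          using block_values(1)[of "int m - 2" m] m4 by simp
        have e: "(int m - 2) mod int m = int m - 2" using m8 by (intro mod_pos_pos_trivial) auto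
        show "0 \<le> excessA (blockA m) (blockB m) x" if "x mod int m \<noteq> (int m - 2) mod int m" for x
          using that[unfolded e] m8 r by (intro block_excessA) (auto simp: r_def)
        show "weight m a b \<noteq> int (2 * q + 3)" if "covering m a b" for a b
          using no_covering_4[OF that m4 m19] by simp
      qed (use weight r m m8 in \<open>auto simp: periodic_block block_excessB\<close>)
      moreover have "n \<noteq> 18" "n \<noteq> 28" using n m19 by auto
      ultimately show ?thesis using n10 r by simp
    qed
  qed
qed

end
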